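(* Let $A\in\mathcal{A}$ and let $\delta>0$ be a real number. Then there exists a rational function $S:\hat{\mathbb{C}}\to\hat{\mathbb{C}}$ for which $\infty$ is an attracting fixed point and (i) $d_H(A,\mathcal{K}(S))<\delta$; (ii) $d_H(A_\infty\sqcup A_0,\mathcal{L}(S))<\delta$; (iii) $d_H(\partial A,\mathcal{J}(S))<\delta$.
   Context: $\hat{\mathbb{C}}=\mathbb{C}\cup\{\infty\}$ is the Riemann sphere. For a rational map $f$ of $\hat{\mathbb{C}}$ for which $\infty$ is an attracting fixed point: $\mathcal{L}(f)$ is the basin of attraction of $\infty$ for $f$ (the set of points whose forward iterates converge to $\infty$), $\mathcal{K}(f)=\hat{\mathbb{C}}\setminus\mathcal{L}(f)$, and $\mathcal{J}(f)=\partial\mathcal{K}(f)$. $\mathcal{A}$ is the collection of all subsets $A\subset\hat{\mathbb{C}}$ that are the closure of an open annulus which is bounded (i.e. disjoint from some ball about $\infty$). Standing assumption on $A\in\mathcal{A}$: $\hat{\mathbb{C}}\setminus A$ consists of two topological disks, denoted $A_\infty$ (unbounded, containing $\infty$) and $A_0$ (bounded), so $\hat{\mathbb{C}}=A_\infty\sqcup A\sqcup A_0$. For nonempty $X,Y\subset\mathbb{C}$, the Hausdorff distance is $d_H(X,Y)=\inf\{\epsilon>0: X\subseteq N_\epsilon(Y)\text{ and }Y\subseteq N_\epsilon(X)\}$, where $N_\epsilon(X)=\bigcup_{x\in X}\{z: d(z,x)\le\epsilon\}$ and $d$ is the Euclidean distance. If $X,Y\subset\hat{\mathbb{C}}$ both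 contain an open ball about $\infty$, then $d_H(X,Y)$ means $d_H(X\setminus B,Y\setminus B)$, where $B=\{|z|>R\}\cup\{\infty\}$ is a sufficiently small such ball (i.e. $R$ sufficiently large) contained in both $X$ and $Y$; the value does not depend on $R$ once $R$ is large enough. *)

theory Defs
  imports
    "HOL-Complex_Analysis.Complex_Analysis"
    "HOL-Computational_Algebra.Computational_Algebra"
begin

section \<open>The Riemann sphere\<close>

datatype riemann_sphere = Fin complex | Infty

text \<open>The topology of the one-point compactification of the complex plane.\<close>

instantiation riemann_sphere :: topological_space
begin

definition open_riemann_sphere :: "riemann_sphere set \<Rightarrow> bool" where
  "open U \<longleftrightarrow> open (Fin -` U) \<and> (Infty \<in> U \<longrightarrow> compact (- (Fin -` U)))"

instance
proof
  show "open (UNIV :: riemann_sphere set)"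
    by (simp add: open_riemann_sphere_def)
next
  fix S T :: "riemann_sphere set"
  assume "open S" "open T"
  then show "open (S \<inter> T)"
    by (auto simp: open_riemann_sphere_def Compl_Int)
next
  fix K :: "riemann_sphere set set"
  assume K: "\<forall>S\<in>K. open S"
  have eq: "Fin -` \<Union>K = (\<Union>S\<in>K. Fin -` S)"
    by auto
  have op: "open (Fin -` \<Union>K)"
    unfolding eq using K by (auto simp: open_riemann_sphere_def)
  moreover have "compact (- (Fin -` \<Union>K))" if inf: "Infty \<in> \<Union>K"
  proof -
    obtain S where S: "S \<in> K" "Infty \<in> S"
      using inf by auto
    then have "compact (- (Fin -` S))"
      using K by (auto simp: open_riemann_sphere_def)
    moreover have "closed (- (Fin -` \<Union>K))"
      using op by (simp add: closed_def)
    ultimately have "compact (- (Fin -` S) \<inter> - (Fin -` \<Union>K))"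
      by (rule compact_Int_closed)
    moreover have "- (Fin -` S) \<inter> - (Fin -` \<Union>K) = - (Fin -` \<Union>K)"
      using S by auto
    ultimately show ?thesis by simp
  qed
  ultimately show "open (\<Union>K)"
    by (simp add: open_riemann_sphere_def)
qed

end

definition ball_Infty :: "real \<Rightarrow> riemann_sphere set" where
  "ball_Infty R = insert Infty (Fin ` {z. norm z > R})"


section \<open>Rational maps and their basins at infinity\<close>

text \<open>For coprime \<open>p\<close> and \<open>q\<close>, this is the continuous extension of \<open>p / q\<close> to the sphere.\<close>

fun rat_eval :: "complex poly \<Rightarrow> complex poly \<Rightarrow> riemann_sphere \<Rightarrow> riemann_sphere" where
  "rat_eval p q (Fin z) = (if poly q z = 0 then Infty else Fin (poly p z / poly q z))"
| "rat_eval p q Infty =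
     (if degree p > degree q then Infty else Fin (coeff p (degree q) / lead_coeff q))"

definition rational_map :: "(riemann_sphere \<Rightarrow> riemann_sphere) \<Rightarrow> bool" where
  "rational_map f \<longleftrightarrow> (\<exists>p q. q \<noteq> 0 \<and> coprime p q \<and> f = rat_eval p q)"

fun sphere_inversion :: "riemann_sphere \<Rightarrow> riemann_sphere" where
  "sphere_inversion (Fin z) = (if z = 0 then Infty else Fin (1 / z))"
| "sphere_inversion Infty = Fin 0"

text \<open>The map \<open>w \<mapsto> 1 / f (1 / w)\<close>, that is, \<open>f\<close> in the chart \<open>w = 1 / z\<close> at infinity.
  The value \<open>0\<close> at points where this is infinite is a convention; such points stay away
  from \<open>w = 0\<close> when \<open>f\<close> is continuous and fixes \<open>Infty\<close>.\<close>

definition chart_at_Infty :: "(riemann_sphere \<Rightarrow> riemann_sphere) \<Rightarrow> complex \<Rightarrow> complex" where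
  "chart_at_Infty f w =
     (case sphere_inversion (f (sphere_inversion (Fin w))) of Fin z \<Rightarrow> z | Infty \<Rightarrow> 0)"

text \<open>The multiplier \<open>l\<close> may be \<open>0\<close>: superattracting counts as attracting.\<close>

definition attracting_fixpoint_Infty :: "(riemann_sphere \<Rightarrow> riemann_sphere) \<Rightarrow> bool" where
  "attracting_fixpoint_Infty f \<longleftrightarrow>
     f Infty = Infty \<and>
     (\<exists>l. (chart_at_Infty f has_field_derivative l) (at 0) \<and> norm l < 1)"

definition basin_Infty :: "(riemann_sphere \<Rightarrow> riemann_sphere) \<Rightarrow> riemann_sphere set" where
  "basin_Infty f = {z. (\<lambda>n. (f ^^ n) z) \<longlonglongrightarrow> Infty}"

definition filled_julia :: "(riemann_sphere \<Rightarrow> riemann_sphere) \<Rightarrow> riemann_sphere set" where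
  "filled_julia f = - basin_Infty f"

definition julia :: "(riemann_sphere \<Rightarrow> riemann_sphere) \<Rightarrow> riemann_sphere set" where
  "julia f = frontier (filled_julia f)"


section \<open>Annuli and disks\<close>

definition open_annulus :: "riemann_sphere set \<Rightarrow> bool" where
  "open_annulus U \<longleftrightarrow> open U \<and> U homeomorphic {z::complex. 1 < norm z \<and> norm z < 2}"

definition topological_disk :: "riemann_sphere set \<Rightarrow> bool" where
  "topological_disk D \<longleftrightarrow> open D \<and> D homeomorphic ball (0::complex) 1"

definition closed_annuli :: "riemann_sphere set set" where
  "closed_annuli = {closure U |U. open_annulus U \<and> (\<exists>R. U \<inter> ball_Infty R = {})}"


section \<open>Hausdorff distance\<close>

definition nbhd :: "real \<Rightarrow> complex set \<Rightarrow> complex set" where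
  "nbhd e X = (\<Union>x\<in>X. cball x e)"

text \<open>The value is an extended real, so that it is \<open>\<infinity>\<close> rather than
  an arbitrary real number when no \<open>e\<close> qualifies.\<close>

definition hausdorff_dist :: "complex set \<Rightarrow> complex set \<Rightarrow> ereal" where
  "hausdorff_dist X Y = (INF e\<in>{e. e > 0 \<and> X \<subseteq> nbhd e Y \<and> Y \<subseteq> nbhd e X}. ereal e)"

text \<open>On the sphere the distance is meant for two sets of finite points, or for two sets that
  both contain a ball about infinity. In the latter case it is the value obtained
  after removing any sufficiently small such ball; see \<open>hausdorff_dist_eventually_const\<close>.
  For all other pairs it is set to \<open>\<infinity>\<close>.\<close>

definition sphere_hausdorff_dist :: "riemann_sphere set \<Rightarrow> riemann_sphere set \<Rightarrow> ereal" where
  "sphere_hausdorff_dist X Y =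
     (if Infty \<notin> X \<and> Infty \<notin> Y then hausdorff_dist (Fin -` X) (Fin -` Y)
      else if \<exists>R. ball_Infty R \<subseteq> X \<inter> Y then
        (THE d. \<forall>\<^sub>F R in at_top.
           hausdorff_dist (Fin -` (X - ball_Infty R)) (Fin -` (Y - ball_Infty R)) = d)
      else \<infinity>)"

lemma vimage_Diff_ball_Infty: "Fin -` (X - ball_Infty R) = {z. Fin z \<in> X \<and> norm z \<le> R}"
  by (auto simp: ball_Infty_def)

lemma nbhd_truncate:
  fixes X Y :: "complex set"
  assumes Y: "{z. norm z > R0} \<subseteq> Y" and R: "R0 < R" "R \<le> R'" and e: "e > 0"
  shows "X \<inter> cball 0 R \<subseteq> nbhd e (Y \<inter> cball 0 R) \<longleftrightarrow> X \<inter> cball 0 R' \<subseteq> nbhd e (Y \<inter> cball 0 R')"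
proof
  assume L: "X \<inter> cball 0 R \<subseteq> nbhd e (Y \<inter> cball 0 R)"
  show "X \<inter> cball 0 R' \<subseteq> nbhd e (Y \<inter> cball 0 R')"
  proof
    fix x assume x: "x \<in> X \<inter> cball 0 R'"
    show "x \<in> nbhd e (Y \<inter> cball 0 R')"
    proof (cases "norm x \<le> R")
      case True
      then have "x \<in> nbhd e (Y \<inter> cball 0 R)"
        using x L by auto
      then show ?thesis
        using R unfolding nbhd_def by fastforce
    next
      case False
      then have "x \<in> Y"
        using Y R by auto
      then show ?thesis
        using x e unfolding nbhd_def by force
    qed
  qed
next
  assume L: "X \<inter> cball 0 R' \<subseteq> nbhd e (Y \<inter> cball 0 R')"
  show "X \<inter> cball 0 R \<subseteq> nbhd e (Y \<inter> cball 0 R)"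
  proof
    fix x assume x: "x \<in> X \<inter> cball 0 R"
    then have "x \<in> nbhd e (Y \<inter> cball 0 R')"
      using L R by auto
    then obtain y where y: "y \<in> Y" "dist y x \<le> e"
      by (auto simp: nbhd_def)
    show "x \<in> nbhd e (Y \<inter> cball 0 R)"
    proof (cases "norm y \<le> R")
      case True
      then show ?thesis
        using y by (auto simp: nbhd_def)
    next
      case False
      let ?g = "\<lambda>t::real. x + of_real t * (y - x)"
      have "\<exists>t\<ge>0. t \<le> 1 \<and> norm (?g t) = R"
        by (rule IVT') (use x False in \<open>auto intro!: continuous_intros\<close>)
      then obtain t where t: "0 \<le> t" "t \<le> 1" "norm (?g t) = R"
        by auto
      have "dist (?g t) x = t * norm (y - x)"
        using t by (simp add: dist_norm norm_mult)
      also have "\<dots> \<le> 1 * norm (y - x)"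
        using t by (intro mult_right_mono) auto
      also have "\<dots> \<le> e"
        using y by (simp add: dist_norm)
      finally have "dist (?g t) x \<le> e" .
      moreover have "?g t \<in> Y \<inter> cball 0 R"
        using t Y R by auto
      ultimately show ?thesis
        unfolding nbhd_def by (meson UN_I mem_cball)
    qed
  qed
qed

lemma hausdorff_dist_eventually_const:
  assumes "ball_Infty R0 \<subseteq> X \<inter> Y" "R0 < R" "R \<le> R'"
  shows "hausdorff_dist (Fin -` (X - ball_Infty R)) (Fin -` (Y - ball_Infty R)) =
         hausdorff_dist (Fin -` (X - ball_Infty R')) (Fin -` (Y - ball_Infty R'))"
proof -
  have eq: "Fin -` (Z - ball_Infty r) = (Fin -` Z) \<inter> cball 0 r" for Z r
    by (auto simp: ball_Infty_def)
  have sub: "{z. norm z > R0} \<subseteq> Fin -` X" "{z. norm z > R0} \<subseteq> Fin -` Y"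
    using assms(1) by (auto simp: ball_Infty_def)
  show ?thesis
    unfolding hausdorff_dist_def eq
    using nbhd_truncate[OF sub(1) assms(2,3)] nbhd_truncate[OF sub(2) assms(2,3)]
    by (intro INF_cong Collect_cong refl) (simp cong: conj_cong)
qed

lemma sphere_hausdorff_dist_eq:
  assumes "ball_Infty R0 \<subseteq> X \<inter> Y" "R0 < R"
  shows "sphere_hausdorff_dist X Y =
         hausdorff_dist (Fin -` (X - ball_Infty R)) (Fin -` (Y - ball_Infty R))"
proof -
  let ?h = "\<lambda>R. hausdorff_dist (Fin -` (X - ball_Infty R)) (Fin -` (Y - ball_Infty R))"
  have ev: "\<forall>\<^sub>F R' in at_top. ?h R' = ?h R"
    using eventually_ge_at_top[of R]
    by eventually_elim (metis hausdorff_dist_eventually_const assms)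
  have "(THE d. \<forall>\<^sub>F R' in at_top. ?h R' = d) = ?h R"
  proof (rule the_equality)
    show "\<forall>\<^sub>F R' in at_top. ?h R' = ?h R"
      by (rule ev)
  next
    fix d assume "\<forall>\<^sub>F R' in at_top. ?h R' = d"
    with ev have "\<forall>\<^sub>F R' in at_top :: real filter. ?h R = d"
      by eventually_elim simp
    then show "d = ?h R"
      by simp
  qed
  moreover have "Infty \<in> X"
    using assms(1) by (auto simp: ball_Infty_def)
  ultimately show ?thesis
    using assms(1) unfolding sphere_hausdorff_dist_def by auto
qed

end

theory Submission
  imports Defs
begin

text \<open>The filled Julia set only has to contain a set \<open>E\<close> slightly smaller than \<open>A\<close>, and the basin of
  infinity a set \<open>F\<close> slightly smaller than the complement of \<open>A\<close>.  All three estimates follow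
  from this: \<open>A\<close> is the closure of an open set, so both \<open>A\<close> and its complement are approximated by
  what remains of them after erosion, and near each point of \<open>\<partial>A\<close> there are points of the
  filled Julia set as well as of the basin, hence points of the Julia set
  (\<open>hausdorff_dist_between_inner_parts\<close>).

  The map comes from Runge's theorem for the function that is \<open>1\<close> on \<open>E\<close> and \<open>0\<close> on \<open>F\<close>
  (\<open>rational_approx_indicator\<close>).  If \<open>f\<close> is a rational function close to it which vanishes at
  infinity, then \<open>R = 1 / f - 1\<close> has a pole at infinity, is small on \<open>E\<close> and large on \<open>F\<close>.
  For \<open>a\<close> in the interior of \<open>E\<close> and large \<open>n\<close>, the map \<open>S(z) = a + (z - a) R(z)\<^sup>n\<close> sends \<open>E\<close> into
  itself and moves points of \<open>F\<close> away from \<open>a\<close> by a factor of at least \<open>3\<close>, within \<open>F\<close> or to infinity.  So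
  orbits in \<open>E\<close> are bounded and those in \<open>F\<close> tend to infinity (\<open>rational_map_separating\<close>).

  Runge's theorem is obtained by the classical route.  A fine square grid provides finitely
  many segments off \<open>E \<union> F\<close> whose winding numbers add up to \<open>1\<close> on \<open>E\<close> and to \<open>0\<close> on \<open>F\<close>
  (\<open>exists_separating_segments\<close>), and the Cauchy integrals over these segments are limits of
  Riemann sums, which are rational functions.\<close>

section \<open>Separating a compact set from a closed set by a grid\<close>

text \<open>The boundary of a square as a set of directed edges, anticlockwise.  A directed edge
  determines its square, and reversing it gives an edge of the neighbouring square.\<close>

definition square_edges :: "int \<times> int \<Rightarrow> ((int \<times> int) \<times> (int \<times> int)) set" where
  "square_edges = (\<lambda>(j, k). {((j, k), (j + 1, k)), ((j + 1, k), (j + 1, k + 1)),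
                        ((j + 1, k + 1), (j, k + 1)), ((j, k + 1), (j, k))})"

text \<open>Grid points are kept as pairs of integers, so that the combinatorics of the edges is
  independent of the mesh \<open>d\<close> and of their position in the plane.\<close>

definition grid_point :: "real \<Rightarrow> int \<times> int \<Rightarrow> complex" where
  "grid_point d = (\<lambda>(j, k). Complex (d * of_int j) (d * of_int k))"

definition grid_square :: "real \<Rightarrow> int \<times> int \<Rightarrow> complex set" where
  "grid_square d = (\<lambda>(j, k). cbox (grid_point d (j, k)) (grid_point d (j + 1, k + 1)))"

abbreviation grid_path :: "real \<Rightarrow> (int \<times> int) \<times> (int \<times> int) \<Rightarrow> real \<Rightarrow> complex" where
  "grid_path d e \<equiv> linepath (grid_point d (fst e)) (grid_point d (snd e))"

lemma finite_square_edges [simp]: "finite (square_edges c)"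
  by (cases c) (simp add: square_edges_def)

lemma square_edges_disjoint: "c \<noteq> c' \<Longrightarrow> square_edges c \<inter> square_edges c' = {}"
  by (cases c; cases c') (auto simp: square_edges_def)

lemma swap_in_square_edges:
  assumes "e \<in> square_edges c"
  obtains c' where "prod.swap e \<in> square_edges c'"
proof -
  obtain j k where c: "c = (j, k)" by (cases c)
  have "prod.swap e \<in> square_edges (j, k - 1) \<union> square_edges (j + 1, k) \<union>
      square_edges (j, k + 1) \<union> square_edges (j - 1, k)"
    using assms by (auto simp: c square_edges_def)
  then show ?thesis using that by blast
qed

lemma mem_grid_square:
  "z \<in> grid_square d (j, k) \<longleftrightarrow>
     d * j \<le> Re z \<and> Re z \<le> d * (j + 1) \<and> d * k \<le> Im z \<and> Im z \<le> d * (k + 1)"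
  by (auto simp: grid_square_def grid_point_def in_cbox_complex_iff)

lemma path_image_grid_path_subset:
  assumes "d \<ge> 0" "e \<in> square_edges c"
  shows "path_image (grid_path d e) \<subseteq> grid_square d c"
proof -
  obtain j k where c: "c = (j, k)" by (cases c)
  have "convex (grid_square d c)"
    by (simp add: c grid_square_def)
  moreover have "grid_point d (fst e) \<in> grid_square d c" "grid_point d (snd e) \<in> grid_square d c"
    using assms by (auto simp: c square_edges_def mem_grid_square grid_point_def mult_left_mono)
  ultimately show ?thesis
    by (simp add: closed_segment_subset)
qed

lemma dist_grid_square_le:
  assumes "x \<in> grid_square d c" "y \<in> grid_square d c"
  shows "dist x y \<le> 2 * d"
proof -
  obtain j k where c: "c = (j, k)" by (cases c)
  have "\<bar>Re (x - y)\<bar> \<le> d" "\<bar>Im (x - y)\<bar> \<le> d"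
    using assms by (auto simp: c mem_grid_square algebra_simps)
  with cmod_le[of "x - y"] show ?thesis
    by (simp add: dist_norm)
qed

lemma finite_grid_squares_meeting:
  assumes "bounded E" "d > 0"
  shows "finite {c. grid_square d c \<inter> E \<noteq> {}}"
proof -
  obtain B where B: "\<And>z. z \<in> E \<Longrightarrow> norm z \<le> B"
    using assms(1) by (auto simp: bounded_iff)
  define N where "N = \<lceil>B / d\<rceil> + 1"
  have ind: "j \<in> {-N..N}" if "d * j \<le> t" "t \<le> d * (j + 1)" "\<bar>t\<bar> \<le> B" for j :: int and t
  proof -
    have "d * j \<le> B" "- B \<le> d * (j + 1)"
      using that by auto
    then have "real_of_int j \<le> B / d" "- (B / d) \<le> real_of_int (j + 1)"
      using assms(2) by (simp_all add: field_simps)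
    then show ?thesis
      unfolding N_def using le_of_int_ceiling[of "B / d"]
      by (simp, linarith)
  qed
  have "c \<in> {-N..N} \<times> {-N..N}" if "z \<in> grid_square d c" "z \<in> E" for c z
  proof -
    obtain j k where c: "c = (j, k)" by (cases c)
    have "\<bar>Re z\<bar> \<le> B" "\<bar>Im z\<bar> \<le> B"
      using B[OF that(2)] abs_Re_le_cmod[of z] abs_Im_le_cmod[of z] by linarith+
    then show ?thesis
      using that(1) ind[of j "Re z"] ind[of k "Im z"] by (auto simp: c mem_grid_square)
  qed
  then have "{c. grid_square d c \<inter> E \<noteq> {}} \<subseteq> {-N..N} \<times> {-N..N}"
    by blast
  then show ?thesis
    by (rule finite_subset) simp
qed

lemma ex_grid_square:
  assumes "d > 0"
  obtains c where "z \<in> grid_square d c"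
proof
  have "d * \<lfloor>x / d\<rfloor> \<le> x \<and> x \<le> d * (\<lfloor>x / d\<rfloor> + 1)" for x
  proof -
    have "real_of_int \<lfloor>x / d\<rfloor> \<le> x / d" "x / d \<le> real_of_int \<lfloor>x / d\<rfloor> + 1"
      by linarith+
    then show ?thesis
      using assms by (simp only: pos_le_divide_eq pos_divide_le_eq) (simp add: mult.commute)
  qed
  then show "z \<in> grid_square d (\<lfloor>Re z / d\<rfloor>, \<lfloor>Im z / d\<rfloor>)"
    by (simp add: mem_grid_square)
qed

lemma rectpath_eq_grid_paths:
  "rectpath (grid_point d (j, k)) (grid_point d (j + 1, k + 1)) =
     grid_path d ((j, k), (j + 1, k)) +++ grid_path d ((j + 1, k), (j + 1, k + 1)) +++
     grid_path d ((j + 1, k + 1), (j, k + 1)) +++ grid_path d ((j, k + 1), (j, k))"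
  by (simp add: rectpath_def grid_point_def Let_def)

lemma sum_winding_number_square_edges:
  assumes "\<And>e. e \<in> square_edges (j, k) \<Longrightarrow> z \<notin> path_image (grid_path d e)"
  shows "(\<Sum>e\<in>square_edges (j, k). winding_number (grid_path d e) z) =
         winding_number (rectpath (grid_point d (j, k)) (grid_point d (j + 1, k + 1))) z"
proof -
  have "z \<notin> path_image (grid_path d ((j, k), (j + 1, k)))"
    "z \<notin> path_image (grid_path d ((j + 1, k), (j + 1, k + 1)))"
    "z \<notin> path_image (grid_path d ((j + 1, k + 1), (j, k + 1)))"
    "z \<notin> path_image (grid_path d ((j, k + 1), (j, k)))"
    by (rule assms, simp add: square_edges_def)+
  then show ?thesis
    by (simp add: rectpath_eq_grid_paths winding_number_join path_image_join square_edges_def)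
qed

lemma interior_grid_square:
  "interior (grid_square d (j, k)) = box (grid_point d (j, k)) (grid_point d (j + 1, k + 1))"
  by (simp add: grid_square_def interior_cbox)

lemma interior_grid_square_notin_edges:
  assumes d: "d > 0" and z: "z \<in> interior (grid_square d c)" and e: "e \<in> square_edges c"
  shows "z \<notin> path_image (grid_path d e)"
proof -
  obtain j k where c: "c = (j, k)" by (cases c)
  have "path_image (grid_path d e) \<subseteq>
      path_image (rectpath (grid_point d (j, k)) (grid_point d (j + 1, k + 1)))"
    using e by (auto simp: c rectpath_eq_grid_paths path_image_join square_edges_def)
  also have "\<dots> = grid_square d c - interior (grid_square d c)"
    unfolding c interior_grid_square unfolding grid_square_def
    using d by (simp add: path_image_rectpath_cbox_minus_box grid_point_def)
  finally show ?thesis using z by blast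
qed

text \<open>Stated with the closed square \<open>c'\<close>: an interior point of one square is then also
  off every edge of the others.\<close>

lemma interior_grid_square_unique:
  assumes d: "d > 0" and z: "z \<in> interior (grid_square d c)" "z \<in> grid_square d c'"
  shows "c' = c"
proof -
  obtain j k j' k' where c: "c = (j, k)" "c' = (j', k')" by (cases c, cases c') auto
  have *: "a = b" if "d * real_of_int a < x" "x < d * real_of_int (a + 1)"
      "d * real_of_int b \<le> x" "x \<le> d * real_of_int (b + 1)" for a b :: int and x
  proof -
    have "d * real_of_int b < d * real_of_int (a + 1)" "d * real_of_int a < d * real_of_int (b + 1)"
      using that by linarith+
    then show ?thesis
      using d by (simp only: mult_less_cancel_left_pos of_int_less_iff)
  qed
  show ?thesis
    using z *[of j "Re z" j'] *[of k "Im z" k']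
    unfolding c interior_grid_square mem_grid_square
    by (simp add: in_box_complex_iff grid_point_def)
qed

text \<open>An edge lying in \<open>T\<close> together with its reverse is paired with it, and the two
  winding numbers cancel; only unpaired edges contribute.\<close>

lemma sum_winding_number_grid_boundary:
  assumes fin: "finite T" and off: "\<And>e. e \<in> T \<Longrightarrow> z \<notin> path_image (grid_path d e)"
  shows "(\<Sum>e\<in>{e \<in> T. prod.swap e \<notin> T}. winding_number (grid_path d e) z) =
         (\<Sum>e\<in>T. winding_number (grid_path d e) z)"
proof -
  let ?w = "\<lambda>e. winding_number (grid_path d e) z"
  let ?P = "{e \<in> T. prod.swap e \<in> T}"
  have rev: "?w (prod.swap e) = - ?w e" if "e \<in> ?P" for e
    using winding_number_reversepath[of "grid_path d e" z] off[of e] that by simp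
  have "sum ?w ?P = sum (\<lambda>e. ?w (prod.swap e)) ?P"
    by (rule sum.reindex_bij_witness[of _ prod.swap prod.swap]) auto
  also have "\<dots> = - sum ?w ?P"
    unfolding sum_negf[symmetric] by (rule sum.cong[OF refl rev])
  finally have "sum ?w ?P = 0"
    by simp
  moreover have "sum ?w T = sum ?w (?P \<union> {e \<in> T. prod.swap e \<notin> T})"
    by (rule sum.cong) auto
  moreover have "\<dots> = sum ?w ?P + sum ?w {e \<in> T. prod.swap e \<notin> T}"
    by (rule sum.union_disjoint) (use fin in auto)
  ultimately show ?thesis by simp
qed

text \<open>The cycle of Runge's theorem.  Take a grid so fine that no square meets both sets, and
  the boundary edges of all squares meeting \<open>E\<close> whose reverse is not also such an edge.
  If an edge meets \<open>E\<close>, then so do both squares adjacent to it, hence it is not retained;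
  it cannot meet \<open>F\<close> either.  The sum of the winding numbers is the sum over the boundaries
  of the squares, which is \<open>1\<close> inside any of them and \<open>0\<close> on \<open>F\<close>.  For a point of \<open>E\<close>
  on a grid line the individual squares have no winding number, but the retained edges
  avoid the point, so the value follows by continuity.\<close>

theorem exists_separating_segments:
  fixes E F :: "complex set"
  assumes E: "compact E" and F: "closed F" and disj: "E \<inter> F = {}"
  obtains T :: "(complex \<times> complex) set" where "finite T"
    "\<And>a b. (a, b) \<in> T \<Longrightarrow> closed_segment a b \<inter> (E \<union> F) = {}"
    "\<And>z. z \<in> E \<Longrightarrow> (\<Sum>(a, b)\<in>T. winding_number (linepath a b) z) = 1"
    "\<And>z. z \<in> F \<Longrightarrow> (\<Sum>(a, b)\<in>T. winding_number (linepath a b) z) = 0"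
proof -
  obtain r where r: "r > 0" "\<And>x y. x \<in> E \<Longrightarrow> y \<in> F \<Longrightarrow> r \<le> dist x y"
    using separate_compact_closed[OF E F disj] by auto
  define d where "d = r / 3"
  have d: "d > 0" and far: "\<And>x y. x \<in> E \<Longrightarrow> y \<in> F \<Longrightarrow> 2 * d < dist x y"
    using r by (force simp: d_def)+
  define C where "C = {c. grid_square d c \<inter> E \<noteq> {}}"
  define T0 where "T0 = (\<Union>c\<in>C. square_edges c)"
  define T1 where "T1 = {e \<in> T0. prod.swap e \<notin> T0}"
  let ?w = "\<lambda>z e. winding_number (grid_path d e) z"
  let ?W = "\<lambda>z c. winding_number
     (rectpath (grid_point d c) (grid_point d (fst c + 1, snd c + 1))) z"
  have finC: "finite C"
    unfolding C_def using finite_grid_squares_meeting compact_imp_bounded[OF E] d by blast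
  then have finT0: "finite T0" and finT1: "finite T1"
    by (auto simp: T0_def T1_def)
  have noF: "z \<notin> grid_square d c" if "c \<in> C" "z \<in> F" for c z
    using that far dist_grid_square_le[of _ d c z] by (fastforce simp: C_def)
  have offE: "z \<notin> path_image (grid_path d e)" if e: "e \<in> T1" and z: "z \<in> E" for e z
  proof
    assume z': "z \<in> path_image (grid_path d e)"
    obtain c where "e \<in> square_edges c"
      using e by (auto simp: T1_def T0_def)
    then obtain c' where c': "prod.swap e \<in> square_edges c'"
      by (rule swap_in_square_edges)
    have "z \<in> path_image (grid_path d (prod.swap e))"
      using z' by (simp add: closed_segment_commute)
    then have "z \<in> grid_square d c'"
      using path_image_grid_path_subset[OF _ c', of d] d by auto
    then have "c' \<in> C"
      using z by (auto simp: C_def)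
    then have "prod.swap e \<in> T0"
      using c' by (auto simp: T0_def)
    then show False
      using e by (simp add: T1_def)
  qed
  have offF: "z \<notin> path_image (grid_path d e)" if "e \<in> T0" "z \<in> F" for e z
    using that noF path_image_grid_path_subset[of d e] d by (fastforce simp: T0_def)
  (* the paired edges may be put back, provided that z lies on none of them *)
  have total: "sum (?w z) T1 = sum (?W z) C"
    if off: "\<And>e. e \<in> T0 \<Longrightarrow> z \<notin> path_image (grid_path d e)" for z
  proof -
    have "sum (?w z) T1 = sum (?w z) T0"
      unfolding T1_def by (rule sum_winding_number_grid_boundary[OF finT0 off])
    also have "\<dots> = (\<Sum>c\<in>C. sum (?w z) (square_edges c))"
      unfolding T0_def by (rule sum.UNION_disjoint) (use finC square_edges_disjoint in auto)
    also have "\<dots> = sum (?W z) C"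
    proof (rule sum.cong[OF refl])
      fix c assume "c \<in> C"
      then have "z \<notin> path_image (grid_path d e)" if "e \<in> square_edges c" for e
        using off that unfolding T0_def by blast
      then show "sum (?w z) (square_edges c) = ?W z c"
        using sum_winding_number_square_edges[of "fst c" "snd c" z d] by simp
    qed
    finally show ?thesis .
  qed
  have outside: "?W z c = 0" if "z \<notin> grid_square d c" for z c
  proof -
    obtain j k where c: "c = (j, k)" by (cases c)
    show ?thesis
      using that d unfolding c grid_square_def
      by (simp add: winding_number_rectpath_outside grid_point_def)
  qed
  have onF: "sum (?w z) T1 = 0" if z: "z \<in> F" for z
    using total[of z] offF[OF _ z] outside noF[OF _ z] by simp
  have onInt: "sum (?w z) T1 = 1" if c: "c \<in> C" and z: "z \<in> interior (grid_square d c)" for z c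
  proof -
    have other: "z \<notin> grid_square d c'" if "c' \<noteq> c" for c'
      using interior_grid_square_unique[OF d z] that by blast
    have "z \<notin> path_image (grid_path d e)" if e: "e \<in> T0" for e
    proof -
      obtain c' where "e \<in> square_edges c'"
        using e unfolding T0_def by blast
      then show ?thesis
        using other[of c'] interior_grid_square_notin_edges[OF d z, of e]
          path_image_grid_path_subset[of d e c'] d by (cases "c' = c") auto
    qed
    then have "sum (?w z) T1 = sum (?W z) C"
      by (rule total)
    also have "\<dots> = ?W z c"
      using finC c other outside by (subst sum.remove[of _ c]) auto
    also have "\<dots> = 1"
    proof -
      obtain j k where "c = (j, k)" by (cases c)
      then show ?thesis
        using z by (auto simp: interior_grid_square intro: winding_number_rectpath)
    qed
    finally show ?thesis .
  qed
  (* on E, approach z from the interior of a square that contains it *)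
  have onE: "sum (?w z) T1 = 1" if z: "z \<in> E" for z
  proof -
    obtain c where c: "z \<in> grid_square d c"
      using ex_grid_square[OF d] .
    obtain j k where jk: "c = (j, k)" by (cases c)
    have "c \<in> C"
      using c z by (auto simp: C_def)
    have "grid_square d c = closure (interior (grid_square d c))"
      using d unfolding jk interior_grid_square unfolding grid_square_def
      by (simp, subst closure_box)
         (auto simp: box_ne_empty grid_point_def Basis_complex_def mult_strict_left_mono)
    with c obtain x where x: "\<And>n. x n \<in> interior (grid_square d c)" "x \<longlonglongrightarrow> z"
      by (metis closure_sequential)
    have "isCont (\<lambda>z. sum (?w z) T1) z"
      using offE[OF _ z] by (intro continuous_sum continuous_at_winding_number) auto
    then have "(\<lambda>n. sum (?w (x n)) T1) \<longlonglongrightarrow> sum (?w z) T1"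
      using x(2) by (rule isCont_tendsto_compose)
    then show ?thesis
      using onInt[OF \<open>c \<in> C\<close> x(1)] by (simp add: LIMSEQ_const_iff)
  qed
  let ?g = "\<lambda>e. (grid_point d (fst e), grid_point d (snd e))"
  have "inj (grid_point d)"
    using d by (auto simp: inj_def grid_point_def)
  then have inj: "inj_on ?g T1"
    by (auto simp: inj_on_def inj_def prod_eq_iff)
  have sum_eq: "(\<Sum>(a, b)\<in>?g ` T1. winding_number (linepath a b) z) = sum (?w z) T1" for z
    by (subst sum.reindex[OF inj]) simp
  show ?thesis
  proof (rule that[of "?g ` T1"])
    show "closed_segment a b \<inter> (E \<union> F) = {}" if "(a, b) \<in> ?g ` T1" for a b
      using that offE offF unfolding T1_def by fastforce
  qed (use finT1 sum_eq onE onF in auto)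
qed

section \<open>Rational approximation of an indicator function\<close>

text \<open>A one-point Riemann sum for the Cauchy integral over a segment.  The bound is
  quadratic in the length of the segment, so that it tends to zero under subdivision, and it is
  uniform on the set of points at distance at least \<open>\<eta>\<close>, even when that set is unbounded.\<close>

lemma winding_number_linepath_approx:
  assumes eta: "\<eta> > 0" "\<And>w. w \<in> closed_segment a b \<Longrightarrow> \<eta> \<le> dist w z"
  shows "norm (winding_number (linepath a b) z - (b - a) / (2 * pi * \<i>) / (a - z))
           \<le> (norm (b - a))\<^sup>2 / \<eta>\<^sup>2"
proof -
  let ?f = "\<lambda>w. 1 / (w - z) - 1 / (a - z)"
  have nz: "w - z \<noteq> 0" if "w \<in> closed_segment a b" for w
    using eta that by fastforce
  have int: "(\<lambda>w. 1 / (w - z)) contour_integrable_on linepath a b"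
    using nz by (intro contour_integrable_continuous_linepath continuous_intros) auto
  have bound: "norm (contour_integral (linepath a b) ?f) \<le> norm (b - a) / \<eta>\<^sup>2 * norm (b - a)"
  proof (rule contour_integral_bound_linepath)
    show "?f contour_integrable_on linepath a b"
      using nz by (intro contour_integrable_continuous_linepath continuous_intros) auto
    show "norm (?f w) \<le> norm (b - a) / \<eta>\<^sup>2" if w: "w \<in> closed_segment a b" for w
    proof -
      have "?f w = (a - w) / ((w - z) * (a - z))"
        using nz[OF w] nz[of a] by (simp add: field_simps)
      then have "norm (?f w) = norm (w - a) / (dist w z * dist a z)"
        by (simp add: norm_divide norm_mult dist_norm norm_minus_commute)
      also have "\<dots> \<le> norm (b - a) / (\<eta> * \<eta>)"
        using eta(2)[OF w] eta(2)[of a] eta(1) segment_bound1[OF w]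
        by (intro frac_le mult_mono) auto
      finally show ?thesis by (simp add: power2_eq_square)
    qed
  qed auto
  have "contour_integral (linepath a b) ?f =
      contour_integral (linepath a b) (\<lambda>w. 1 / (w - z)) - (b - a) / (a - z)"
    using int by (subst contour_integral_diff) (auto simp: contour_integrable_continuous_linepath)
  moreover have "winding_number (linepath a b) z =
      1 / (2 * pi * \<i>) * contour_integral (linepath a b) (\<lambda>w. 1 / (w - z))"
    using nz by (intro winding_number_valid_path) auto
  ultimately have "winding_number (linepath a b) z - (b - a) / (2 * pi * \<i>) / (a - z) =
      contour_integral (linepath a b) ?f / (2 * pi * \<i>)"
    by (simp add: diff_divide_distrib mult.commute)
  then have "norm (winding_number (linepath a b) z - (b - a) / (2 * pi * \<i>) / (a - z)) =
      norm (contour_integral (linepath a b) ?f) / (2 * pi)"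
    by (simp add: norm_divide norm_mult)
  also have "\<dots> \<le> norm (contour_integral (linepath a b) ?f) / 1"
    using pi_ge_two by (intro divide_left_mono) auto
  also have "\<dots> \<le> (norm (b - a))\<^sup>2 / \<eta>\<^sup>2"
    using bound by (simp add: power2_eq_square)
  finally show ?thesis .
qed

definition simple_pole_sum :: "(complex \<times> complex) list \<Rightarrow> complex \<Rightarrow> complex" where
  "simple_pole_sum ps z = (\<Sum>(c, w)\<leftarrow>ps. c / (w - z))"

lemma linepath_linepath: "linepath a (linepath a b t) s = linepath a b (s * t)"
  for a b :: complex
  by (simp add: linepath_def algebra_simps)

lemma winding_number_linepath_approx_fine:
  assumes eta: "\<eta> > 0" and e: "e > 0"
  obtains ps where "snd ` set ps \<subseteq> closed_segment a b"
    "\<And>z. (\<And>w. w \<in> closed_segment a b \<Longrightarrow> \<eta> \<le> dist w z) \<Longrightarrow>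
       norm (winding_number (linepath a b) z - simple_pole_sum ps z) \<le> e"
proof -
  obtain N :: nat where N: "(norm (b - a))\<^sup>2 / (e * \<eta>\<^sup>2) < real N"
    using reals_Archimedean2 by blast
  then have "N > 0"
    using e by (cases "N = 0") (auto simp: divide_less_0_iff mult_less_0_iff)
  define p where "p k = linepath a b (real k / real N)" for k
  have p_mem: "p k \<in> closed_segment a b" if "k \<le> N" for k
    unfolding p_def using that \<open>N > 0\<close> by (intro linepath_in_path) simp
  have p_step: "p (Suc k) - p k = (b - a) / of_nat N" for k
    by (simp add: p_def linepath_def scaleR_conv_of_real diff_divide_distrib add_divide_distrib algebra_simps)
  have p_mem': "p k \<in> closed_segment a (p (Suc k))" for k
  proof -
    have "p k = linepath a (p (Suc k)) (real k / real (Suc k))"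
      unfolding p_def linepath_linepath by (simp del: of_nat_Suc)
    then show ?thesis
      using linepath_in_path[of "real k / real (Suc k)" a "p (Suc k)"] by simp
  qed
  have split: "winding_number (linepath a (p n)) z =
      (\<Sum>k<n. winding_number (linepath (p k) (p (Suc k))) z)"
    if "n \<le> N" "z \<notin> closed_segment a b" for n z
    using that(1)
  proof (induction n)
    case 0
    have "p 0 = a" "z \<noteq> a" using that by (auto simp: p_def linepath_0')
    then show ?case
      by (metis lessThan_0 sum.empty winding_number_trivial)
  next
    case (Suc n)
    have "closed_segment a (p (Suc n)) \<subseteq> closed_segment a b"
      using p_mem[OF Suc.prems] by (simp add: subset_closed_segment)
    then show ?case
      using winding_number_split_linepath[OF p_mem'[of n], of z] that Suc by auto
  qed
  define ps where "ps = map (\<lambda>k. ((b - a) / of_nat N / (2 * pi * \<i>), p k)) [0..<N]"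
  show ?thesis
  proof (rule that[of ps])
    show "snd ` set ps \<subseteq> closed_segment a b"
      using p_mem by (auto simp: ps_def)
    fix z assume z: "\<And>w. w \<in> closed_segment a b \<Longrightarrow> \<eta> \<le> dist w z"
    have "z \<notin> closed_segment a b"
      using z[of z] eta by auto
    moreover have "p N = b"
      using \<open>N > 0\<close> by (simp add: p_def linepath_def)
    ultimately have wn: "winding_number (linepath a b) z =
        (\<Sum>k<N. winding_number (linepath (p k) (p (Suc k))) z)"
      using split[of N z] by simp
    have sps: "simple_pole_sum ps z = (\<Sum>k<N. (p (Suc k) - p k) / (2 * pi * \<i>) / (p k - z))"
      unfolding p_step by (simp add: simple_pole_sum_def ps_def o_def interv_sum_list_conv_sum_set_nat atLeast0LessThan)
    have "norm (winding_number (linepath a b) z - simple_pole_sum ps z) \<le>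
        (\<Sum>k<N. (norm (p (Suc k) - p k))\<^sup>2 / \<eta>\<^sup>2)"
      unfolding wn sps sum_subtractf[symmetric]
    proof (rule sum_norm_le, rule winding_number_linepath_approx[OF eta])
      fix k w assume "k \<in> {..<N}" and w: "w \<in> closed_segment (p k) (p (Suc k))"
      then have "closed_segment (p k) (p (Suc k)) \<subseteq> closed_segment a b"
        using p_mem[of k] p_mem[of "Suc k"] by (simp add: subset_closed_segment)
      then show "\<eta> \<le> dist w z"
        using z w by blast
    qed
    also have "\<dots> = (norm (b - a))\<^sup>2 / \<eta>\<^sup>2 / real N"
      using \<open>N > 0\<close> by (simp add: p_step norm_divide power_divide power2_eq_square)
    also have "\<dots> \<le> e"
      using N \<open>N > 0\<close> e eta by (simp add: field_simps)
    finally show "norm (winding_number (linepath a b) z - simple_pole_sum ps z) \<le> e" .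
  qed
qed

lemma simple_pole_sum_sum_approx:
  assumes T: "finite T" and eta: "\<eta> > 0" and e: "e > 0"
    and X: "\<And>a b w z. (a, b) \<in> T \<Longrightarrow> w \<in> closed_segment a b \<Longrightarrow> z \<in> X \<Longrightarrow> \<eta> \<le> dist w z"
  shows "\<exists>ps. snd ` set ps \<inter> X = {} \<and>
    (\<forall>z\<in>X. norm ((\<Sum>(a, b)\<in>T. winding_number (linepath a b) z) - simple_pole_sum ps z)
       \<le> real (card T) * e)"
  using T X
proof (induction T rule: finite_induct)
  case empty
  show ?case
    by (rule exI[of _ "[]"]) (simp add: simple_pole_sum_def)
next
  case (insert s T)
  obtain a b where s: "s = (a, b)" by (cases s)
  have "\<exists>ps. snd ` set ps \<inter> X = {} \<and> (\<forall>z\<in>X.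
      norm ((\<Sum>(a, b)\<in>T. winding_number (linepath a b) z) - simple_pole_sum ps z)
        \<le> real (card T) * e)"
    by (rule insert.IH) (rule insert.prems[OF insertI2])
  then obtain ps where ps: "snd ` set ps \<inter> X = {}"
    "\<And>z. z \<in> X \<Longrightarrow> norm ((\<Sum>(a, b)\<in>T. winding_number (linepath a b) z) - simple_pole_sum ps z)
       \<le> real (card T) * e"
    by blast
  obtain qs where qs: "snd ` set qs \<subseteq> closed_segment a b"
    "\<And>z. (\<And>w. w \<in> closed_segment a b \<Longrightarrow> \<eta> \<le> dist w z) \<Longrightarrow>
       norm (winding_number (linepath a b) z - simple_pole_sum qs z) \<le> e"
    by (rule winding_number_linepath_approx_fine[OF eta e]) blast
  have far: "\<eta> \<le> dist w z" if "w \<in> closed_segment a b" "z \<in> X" for w z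
    using insert.prems[of a b] that by (simp add: s)
  have "z \<notin> closed_segment a b" if "z \<in> X" for z
    using far[OF _ that, of z] eta by auto
  then have "snd ` set (ps @ qs) \<inter> X = {}"
    using ps(1) qs(1) by auto
  moreover have "norm ((\<Sum>(a, b)\<in>insert s T. winding_number (linepath a b) z)
      - simple_pole_sum (ps @ qs) z) \<le> real (card (insert s T)) * e" if z: "z \<in> X" for z
  proof -
    have "(\<Sum>(a, b)\<in>insert s T. winding_number (linepath a b) z) - simple_pole_sum (ps @ qs) z =
       ((\<Sum>(a, b)\<in>T. winding_number (linepath a b) z) - simple_pole_sum ps z) +
       (winding_number (linepath a b) z - simple_pole_sum qs z)"
      using insert.hyps by (simp add: s simple_pole_sum_def)
    also have "norm \<dots> \<le> real (card T) * e + e"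
      using ps(2)[OF z] qs(2)[of z] far[OF _ z] by (intro norm_triangle_mono) auto
    finally show ?thesis
      using insert.hyps by (simp add: algebra_simps)
  qed
  ultimately show ?case by blast
qed

text \<open>The degree bound says that the sum vanishes at infinity.  This is what will turn
  \<open>q / p - 1\<close> into a function with a pole there.\<close>

lemma simple_pole_sum_eq_quotient:
  "\<exists>p q. q \<noteq> 0 \<and> (p = 0 \<or> degree p < degree q) \<and> (\<forall>z. poly q z = 0 \<longrightarrow> z \<in> snd ` set ps) \<and>
     (\<forall>z. poly q z \<noteq> 0 \<longrightarrow> simple_pole_sum ps z = poly p z / poly q z)"
proof (induction ps)
  case Nil
  show ?case
    by (rule exI[of _ 0], rule exI[of _ 1]) (auto simp: simple_pole_sum_def)
next
  case (Cons x ps)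
  obtain c u where x: "x = (c, u)" by (cases x)
  obtain p q where q: "q \<noteq> 0" and pq: "p = 0 \<or> degree p < degree q"
    "\<And>z. poly q z = 0 \<Longrightarrow> z \<in> snd ` set ps"
    "\<And>z. poly q z \<noteq> 0 \<Longrightarrow> simple_pole_sum ps z = poly p z / poly q z"
    using Cons.IH by blast
  let ?l = "[:u, -1:] :: complex poly"
  show ?case
  proof (intro exI conjI allI impI)
    have "degree (?l * q) = Suc (degree q)"
      using q by (subst degree_mult_eq) auto
    moreover have "degree (smult c q + ?l * p) \<le> degree q"
    proof (rule degree_add_le)
      have "degree (?l * p) \<le> 1 + degree p"
        using degree_mult_le[of ?l p] by simp
      then show "degree (?l * p) \<le> degree q"
        using pq(1) by (cases "p = 0") auto
    qed simp
    ultimately show "smult c q + ?l * p = 0 \<or> degree (smult c q + ?l * p) < degree (?l * q)"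
      by linarith
    show "?l * q \<noteq> 0"
      unfolding mult_eq_0_iff using q by simp
    show "z \<in> snd ` set (x # ps)" if "poly (?l * q) z = 0" for z
      using that pq(2)[of z] by (auto simp: x)
    show "simple_pole_sum (x # ps) z = poly (smult c q + ?l * p) z / poly (?l * q) z"
      if "poly (?l * q) z \<noteq> 0" for z
      using that pq(3)[of z] by (simp add: x simple_pole_sum_def field_simps)
  qed
qed

text \<open>By the fundamental theorem of algebra, a common divisor of positive degree has a
  root.\<close>

lemma coprime_poly_iff_no_common_root:
  fixes p q :: "complex poly"
  shows "coprime p q \<longleftrightarrow> (\<nexists>z. poly p z = 0 \<and> poly q z = 0)"
proof
  assume cop: "coprime p q"
  show "\<nexists>z. poly p z = 0 \<and> poly q z = 0"
  proof
    assume "\<exists>z. poly p z = 0 \<and> poly q z = 0"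
    then obtain z where "[:- z, 1:] dvd p" "[:- z, 1:] dvd q"
      by (auto simp: poly_eq_0_iff_dvd)
    then have "is_unit [:- z, 1:]"
      using cop coprime_common_divisor by blast
    then show False
      by (simp add: is_unit_pCons_iff)
  qed
next
  assume none: "\<nexists>z. poly p z = 0 \<and> poly q z = 0"
  show "coprime p q"
  proof (rule coprimeI)
    fix d assume d: "d dvd p" "d dvd q"
    have "poly d z \<noteq> 0" for z
      using none d by (metis dvd_trans poly_eq_0_iff_dvd)
    then have "degree d = 0" "d \<noteq> 0"
      using fundamental_theorem_of_algebra[of d] constant_degree[of d] by auto
    then show "is_unit d"
      by (simp add: is_unit_iff_degree)
  qed
qed

text \<open>The assumption \<open>p \<noteq> 0\<close> matters: the quotient \<open>0 / q\<close> in lowest terms is \<open>0 / 1\<close>,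
  which is no longer of negative degree.\<close>

lemma cancel_common_factors:
  fixes p q :: "complex poly"
  assumes "p \<noteq> 0" "q \<noteq> 0"
  shows "\<exists>p' q'. coprime p' q' \<and> (degree p < degree q \<longrightarrow> degree p' < degree q') \<and>
    (\<forall>z. poly q z \<noteq> 0 \<longrightarrow> poly q' z \<noteq> 0 \<and> poly p' z / poly q' z = poly p z / poly q z)"
  using assms
proof (induction "degree q" arbitrary: p q rule: less_induct)
  case less
  show ?case
  proof (cases "coprime p q")
    case True
    then show ?thesis by blast
  next
    case False
    then obtain z where "[:- z, 1:] dvd p" "[:- z, 1:] dvd q"
      by (auto simp: coprime_poly_iff_no_common_root poly_eq_0_iff_dvd)
    then obtain p1 q1 where pq: "p = [:- z, 1:] * p1" "q = [:- z, 1:] * q1"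
      by (auto elim!: dvdE)
    then have nz: "p1 \<noteq> 0" "q1 \<noteq> 0"
      using less.prems by auto
    have deg: "degree p = Suc (degree p1)" "degree q = Suc (degree q1)"
      unfolding pq using nz by (subst degree_mult_eq; simp)+
    obtain p' q' where IH: "coprime p' q'" "degree p1 < degree q1 \<Longrightarrow> degree p' < degree q'"
      "\<And>z. poly q1 z \<noteq> 0 \<Longrightarrow> poly q' z \<noteq> 0 \<and> poly p' z / poly q' z = poly p1 z / poly q1 z"
      using less.hyps[of q1 p1] nz deg by auto
    have "poly q' x \<noteq> 0 \<and> poly p' x / poly q' x = poly p x / poly q x" if "poly q x \<noteq> 0" for x
    proof -
      have "poly p x = (x - z) * poly p1 x" "poly q x = (x - z) * poly q1 x"
        by (simp_all add: pq algebra_simps)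
      then show ?thesis
        using IH(3)[of x] that by simp
    qed
    then show ?thesis
      using IH(1,2) deg by auto
  qed
qed

text \<open>Runge's theorem for the function that is \<open>1\<close> near \<open>E\<close> and \<open>0\<close> near \<open>F\<close> and infinity:
  replace the winding numbers of the separating segments by Riemann sums.\<close>

theorem rational_approx_indicator:
  assumes E: "compact E" "E \<noteq> {}" and F: "closed F" and disj: "E \<inter> F = {}" and e: "0 < e" "e < 1"
  obtains p q :: "complex poly" where "coprime p q" "degree p < degree q"
    "\<And>z. z \<in> E \<union> F \<Longrightarrow> poly q z \<noteq> 0"
    "\<And>z. z \<in> E \<Longrightarrow> norm (poly p z / poly q z - 1) \<le> e"
    "\<And>z. z \<in> F \<Longrightarrow> norm (poly p z / poly q z) \<le> e"
proof -
  obtain T :: "(complex \<times> complex) set" where T: "finite T"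
    "\<And>a b. (a, b) \<in> T \<Longrightarrow> closed_segment a b \<inter> (E \<union> F) = {}"
    "\<And>z. z \<in> E \<Longrightarrow> (\<Sum>(a, b)\<in>T. winding_number (linepath a b) z) = 1"
    "\<And>z. z \<in> F \<Longrightarrow> (\<Sum>(a, b)\<in>T. winding_number (linepath a b) z) = 0"
    using exists_separating_segments[OF E(1) F disj] by blast
  let ?D = "\<Union>(a, b)\<in>T. closed_segment a b"
  have "compact ?D"
    using T(1) by (intro compact_UN) auto
  moreover have "closed (E \<union> F)"
    using E F by (simp add: compact_imp_closed closed_Un)
  moreover have "?D \<inter> (E \<union> F) = {}"
    using T(2) by blast
  ultimately have "\<exists>\<eta>>0. \<forall>w\<in>?D. \<forall>z\<in>E \<union> F. \<eta> \<le> dist w z"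
    by (rule separate_compact_closed)
  then obtain \<eta> where eta: "\<eta> > 0"
    "\<And>w z. w \<in> ?D \<Longrightarrow> z \<in> E \<union> F \<Longrightarrow> \<eta> \<le> dist w z"
    by blast
  (* an equal share of the error for each segment; the + 1 covers the empty set *)
  define e' where "e' = e / (card T + 1)"
  have e': "e' > 0" "card T * e' \<le> e"
    using e by (auto simp: e'_def field_simps)
  have far: "\<eta> \<le> dist w z" if "(a, b) \<in> T" "w \<in> closed_segment a b" "z \<in> E \<union> F" for a b w z
    using eta(2)[of w z] that by auto
  have "\<exists>ps. snd ` set ps \<inter> (E \<union> F) = {} \<and> (\<forall>z\<in>E \<union> F.
      norm ((\<Sum>(a, b)\<in>T. winding_number (linepath a b) z) - simple_pole_sum ps z) \<le> card T * e')"
    by (rule simple_pole_sum_sum_approx[OF T(1) eta(1) e'(1)]) (rule far)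
  then obtain ps where ps: "snd ` set ps \<inter> (E \<union> F) = {}"
    "\<And>z. z \<in> E \<union> F \<Longrightarrow>
      norm ((\<Sum>(a, b)\<in>T. winding_number (linepath a b) z) - simple_pole_sum ps z) \<le> card T * e'"
    by blast
  have approx: "norm (simple_pole_sum ps z - (\<Sum>(a, b)\<in>T. winding_number (linepath a b) z)) \<le> e"
    if "z \<in> E \<union> F" for z
    using ps(2)[OF that] e'(2) by (simp add: norm_minus_commute)
  obtain z0 where z0: "z0 \<in> E" using E by blast
  obtain p q where q0: "q \<noteq> 0" and pq: "p = 0 \<or> degree p < degree q"
    "\<And>z. poly q z = 0 \<Longrightarrow> z \<in> snd ` set ps"
    "\<And>z. poly q z \<noteq> 0 \<Longrightarrow> simple_pole_sum ps z = poly p z / poly q z"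
    using simple_pole_sum_eq_quotient by blast
  have q: "poly q z \<noteq> 0" if "z \<in> E \<union> F" for z
    using pq(2)[of z] ps(1) that by blast
  have "norm (simple_pole_sum ps z0 - 1) \<le> e"
    using approx[of z0] z0 T(3) by simp
  then have "simple_pole_sum ps z0 \<noteq> 0"
    using e by auto
  then have p0: "p \<noteq> 0"
    using pq(3)[of z0] q[of z0] z0 by auto
  then obtain p' q' where pq': "coprime p' q'" "degree p' < degree q'"
    "\<And>z. poly q z \<noteq> 0 \<Longrightarrow> poly q' z \<noteq> 0 \<and> poly p' z / poly q' z = poly p z / poly q z"
    using cancel_common_factors[OF p0 q0] pq(1) by blast
  have eq: "poly p' z / poly q' z = simple_pole_sum ps z" if "z \<in> E \<union> F" for z
    using pq'(3)[of z] pq(3)[of z] q[OF that] by simp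
  show ?thesis
  proof (rule that[OF pq'(1,2)])
    show "poly q' z \<noteq> 0" if "z \<in> E \<union> F" for z
      using q[OF that] pq'(3) by blast
    show "norm (poly p' z / poly q' z - 1) \<le> e" if "z \<in> E" for z
      using approx[of z] eq[of z] T(3)[OF that] that by simp
    show "norm (poly p' z / poly q' z) \<le> e" if "z \<in> F" for z
      using approx[of z] eq[of z] T(4)[OF that] that by simp
  qed
qed

section \<open>Erosion and the Hausdorff distance\<close>

text \<open>A finite \<open>e\<close>-net of the bounded set may be chosen inside it, and its finitely many points have a
  common distance \<open>\<epsilon>\<close> to the complement of \<open>W\<close>.  The truncation by \<open>B\<close> makes the lemma
  applicable to an unbounded \<open>W\<close>.\<close>

lemma uniform_inner_approx:
  fixes W B :: "'a::heine_borel set"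
  assumes W: "open W" and bdd: "bounded (W \<inter> B)" and e: "e > 0"
  obtains \<epsilon> where "\<epsilon> > 0"
    "\<And>x. x \<in> W \<inter> B \<Longrightarrow> \<exists>y\<in>W \<inter> B. dist x y < e \<and> ball y \<epsilon> \<subseteq> W"
proof -
  have comp: "compact (closure (W \<inter> B))"
    using bdd by (simp add: compact_closure)
  have cover: "closure (W \<inter> B) \<subseteq> (\<Union>y\<in>W \<inter> B. ball y e)"
  proof
    fix x assume "x \<in> closure (W \<inter> B)"
    then obtain y where "y \<in> W \<inter> B" "dist y x < e"
      using e unfolding closure_approachable by blast
    then show "x \<in> (\<Union>y\<in>W \<inter> B. ball y e)"
      by (intro UN_I[of y]) simp_all
  qed
  obtain D where D: "D \<subseteq> W \<inter> B" "finite D" "closure (W \<inter> B) \<subseteq> (\<Union>y\<in>D. ball y e)"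
    by (rule compactE_image[OF comp _ cover]) simp
  have "\<forall>y\<in>W. \<exists>r>0. ball y r \<subseteq> W"
    using W by (simp add: open_contains_ball)
  then obtain r where r: "\<And>y. y \<in> W \<Longrightarrow> r y > 0 \<and> ball y (r y) \<subseteq> W"
    by metis
  define \<epsilon> where "\<epsilon> = Min (insert 1 (r ` D))"
  have le: "\<epsilon> \<le> r y" if "y \<in> D" for y
    using D(2) that by (simp add: \<epsilon>_def)
  show ?thesis
  proof (rule that)
    show "\<epsilon> > 0"
      using D r by (auto simp: \<epsilon>_def)
    fix x assume "x \<in> W \<inter> B"
    then have "x \<in> closure (W \<inter> B)"
      using closure_subset by (rule rev_subsetD)
    then have "x \<in> (\<Union>y\<in>D. ball y e)"
      using D(3) by (rule rev_subsetD)
    then obtain y where y: "y \<in> D" "dist y x < e"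
      by (elim UN_E) simp
    moreover have yW: "y \<in> W"
      using y(1) D(1) by blast
    moreover have "ball y \<epsilon> \<subseteq> W"
      using r[OF yW] subset_ball[OF le[OF y(1)], of y] by (blast intro: subset_trans)
    ultimately show "\<exists>y\<in>W \<inter> B. dist x y < e \<and> ball y \<epsilon> \<subseteq> W"
      using D(1) by (intro bexI[of _ y]) (auto simp: dist_commute)
  qed
qed

definition inner_part :: "real \<Rightarrow> 'a::metric_space set \<Rightarrow> 'a set" where
  "inner_part \<epsilon> X = {y. ball y \<epsilon> \<subseteq> X}"

lemma notin_inner_part:
  "y \<notin> inner_part \<epsilon> X \<longleftrightarrow> (\<exists>x. x \<notin> X \<and> dist y x < \<epsilon>)"
  by (auto simp: inner_part_def subset_iff)

lemma closed_inner_part: "closed (inner_part \<epsilon> X)"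
proof -
  have "- inner_part \<epsilon> X = (\<Union>x\<in>- X. ball x \<epsilon>)"
    by (auto simp: inner_part_def subset_iff dist_commute)
  then have "open (- inner_part \<epsilon> X)"
    by (simp only:) (intro open_UN ballI open_ball)
  then show ?thesis
    by (simp add: closed_def)
qed

lemma inner_part_subset: "\<epsilon> > 0 \<Longrightarrow> inner_part \<epsilon> X \<subseteq> X"
  unfolding inner_part_def using centre_in_ball by blast

lemma hausdorff_dist_le:
  assumes "e > 0" "\<And>x. x \<in> X \<Longrightarrow> \<exists>y\<in>Y. dist x y \<le> e" "\<And>y. y \<in> Y \<Longrightarrow> \<exists>x\<in>X. dist y x \<le> e"
  shows "hausdorff_dist X Y \<le> ereal e"
  unfolding hausdorff_dist_def
  using assms by (intro INF_lower) (auto simp: nbhd_def dist_commute)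

lemma ball_meets_frontier:
  fixes x :: "'a::real_normed_vector"
  assumes "y \<in> T" "dist x y < e" "z \<notin> T" "dist x z < e"
  obtains w where "w \<in> frontier T" "dist x w < e"
proof -
  have "y \<in> ball x e \<inter> T" "z \<in> ball x e - T"
    using assms by auto
  then have "ball x e \<inter> frontier T \<noteq> {}"
    by (intro connected_Int_frontier) auto
  then show ?thesis using that by auto
qed

text \<open>A set \<open>K\<close> squeezed between \<open>X\<close> eroded by \<open>\<epsilon>\<close> and \<open>X\<close> thickened by \<open>\<epsilon>\<close> is close to \<open>X\<close>, and
  their complements and frontiers are close as well, if \<open>X\<close> and its complement are close to
  their own eroded parts.  For the frontiers: near a frontier point of one set there are
  points inside and outside of the other, hence a frontier point of the other.  The margin
  \<open>e\<close> between \<open>X\<close> and the circle of radius \<open>R\<close> keeps all nearby points needed for the complements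
  inside the truncation.\<close>

lemma hausdorff_dist_between_inner_parts:
  fixes X K :: "complex set"
  assumes eps: "0 < \<epsilon>" "\<epsilon> \<le> e"
    and K: "inner_part \<epsilon> X \<subseteq> K" "K \<inter> inner_part \<epsilon> (- X) = {}"
    and X: "closed X" "X \<subseteq> cball 0 (R - e)"
    and inner: "\<And>x. x \<in> X \<Longrightarrow> \<exists>y\<in>inner_part \<epsilon> X. dist x y < e"
    and outer: "\<And>x. x \<notin> X \<Longrightarrow> norm x \<le> R \<Longrightarrow> \<exists>y\<in>inner_part \<epsilon> (- X). norm y \<le> R \<and> dist x y < e"
  shows "hausdorff_dist X K \<le> ereal e"
    and "hausdorff_dist (- X \<inter> cball 0 R) (- K \<inter> cball 0 R) \<le> ereal e"
    and "hausdorff_dist (frontier X) (frontier K) \<le> ereal (2 * e)"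
proof -
  have e: "e > 0" using eps by simp
  have nearX: "\<exists>x\<in>X. dist k x < \<epsilon>" if "k \<in> K" for k
    using that K(2) notin_inner_part[of k \<epsilon> "- X"] by auto
  have nearC: "\<exists>x. x \<notin> X \<and> dist k x < \<epsilon>" if "k \<notin> K" for k
    using that K(1) notin_inner_part[of k \<epsilon> X] by auto
  show "hausdorff_dist X K \<le> ereal e"
  proof (rule hausdorff_dist_le[OF e])
    show "\<exists>y\<in>K. dist x y \<le> e" if x: "x \<in> X" for x
    proof -
      obtain y where "y \<in> inner_part \<epsilon> X" "dist x y < e" using inner[OF x] by blast
      then show ?thesis using K(1) by (intro bexI[of _ y]) auto
    qed
    show "\<exists>x\<in>X. dist k x \<le> e" if k: "k \<in> K" for k
    proof -
      obtain x where "x \<in> X" "dist k x < \<epsilon>" using nearX[OF k] by blast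
      then show ?thesis using eps(2) by (intro bexI[of _ x]) auto
    qed
  qed
  show "hausdorff_dist (- X \<inter> cball 0 R) (- K \<inter> cball 0 R) \<le> ereal e"
  proof (rule hausdorff_dist_le[OF e])
    fix x assume "x \<in> - X \<inter> cball 0 R"
    then obtain y where "y \<in> inner_part \<epsilon> (- X)" "norm y \<le> R" "dist x y < e"
      using outer[of x] by auto
    then show "\<exists>y\<in>- K \<inter> cball 0 R. dist x y \<le> e"
      using K(2) by (intro bexI[of _ y]) auto
  next
    fix y assume y: "y \<in> - K \<inter> cball 0 R"
    show "\<exists>x\<in>- X \<inter> cball 0 R. dist y x \<le> e"
    proof (cases "y \<in> X")
      case False
      then show ?thesis using y e by (intro bexI[of _ y]) auto
    next
      case True
      obtain x where x: "x \<notin> X" "dist y x < \<epsilon>"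
        using nearC y by auto
      have "norm x \<le> norm y + dist y x"
        using norm_triangle_sub[of x y] by (simp add: dist_norm norm_minus_commute)
      also have "\<dots> \<le> R"
        using True X(2) x(2) eps by auto
      finally show ?thesis
        using x eps by (intro bexI[of _ x]) auto
    qed
  qed
  show "hausdorff_dist (frontier X) (frontier K) \<le> ereal (2 * e)"
  proof (rule hausdorff_dist_le)
    fix x assume x: "x \<in> frontier X"
    then have xX: "x \<in> X"
      using X(1) by (simp add: frontier_def)
    then obtain y where y: "y \<in> K" "dist x y < e"
      using inner K(1) by blast
    have "x \<in> closure (- X)"
      using x by (simp add: frontier_closures)
    then obtain x' where x': "x' \<notin> X" "dist x' x < e"
      using e by (auto simp: closure_approachable)
    have "norm x' \<le> norm x + dist x' x"
      using norm_triangle_sub[of x' x] by (simp add: dist_norm)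
    also have "\<dots> \<le> R"
      using xX X(2) x' by auto
    finally obtain y' where y': "y' \<in> inner_part \<epsilon> (- X)" "dist x' y' < e"
      using outer x'(1) by blast
    have "y' \<notin> K" "dist x y' < 2 * e"
      using y' K(2) x'(2) dist_triangle[of x y' x'] by (auto simp: dist_commute)
    then show "\<exists>w\<in>frontier K. dist x w \<le> 2 * e"
      using y e by - (rule ball_meets_frontier[of y K x "2 * e" y']; force)
  next
    fix k assume k: "k \<in> frontier K"
    have "k \<in> closure K" "k \<in> closure (- K)"
      using k by (simp_all add: frontier_closures)
    then obtain k1 k2 where k1: "k1 \<in> K" "dist k1 k < e" and k2: "k2 \<notin> K" "dist k2 k < e"
      using e unfolding closure_approachable by blast
    obtain x1 where x1: "x1 \<in> X" "dist k1 x1 < \<epsilon>" using nearX k1 by blast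
    obtain x2 where x2: "x2 \<notin> X" "dist k2 x2 < \<epsilon>" using nearC k2 by blast
    have "dist k x1 < 2 * e" "dist k x2 < 2 * e"
      using dist_triangle[of k x1 k1] dist_triangle[of k x2 k2] k1 k2 x1 x2 eps
      by (auto simp: dist_commute)
    then show "\<exists>w\<in>frontier X. dist k w \<le> 2 * e"
      using x1 x2 by - (rule ball_meets_frontier[of x1 X k "2 * e" x2]; force)
  qed (use e in auto)
qed

section \<open>Finite points and neighbourhoods of infinity\<close>

lemma open_vimage_Fin: "open U \<Longrightarrow> open (Fin -` U)"
  by (simp add: open_riemann_sphere_def)

lemma open_image_Fin: "open U \<Longrightarrow> open (Fin ` U)"
  by (auto simp: open_riemann_sphere_def inj_vimage_image_eq inj_def)

lemma vimage_Fin_interior: "Fin -` interior Y = interior (Fin -` Y)"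
proof
  show "Fin -` interior Y \<subseteq> interior (Fin -` Y)"
    by (rule interior_maximal) (use interior_subset in \<open>auto intro: open_vimage_Fin\<close>)
  show "interior (Fin -` Y) \<subseteq> Fin -` interior Y"
  proof
    fix z assume "z \<in> interior (Fin -` Y)"
    moreover have "Fin ` interior (Fin -` Y) \<subseteq> interior Y"
      by (rule interior_maximal) (use interior_subset in \<open>auto intro: open_image_Fin\<close>)
    ultimately show "z \<in> Fin -` interior Y" by auto
  qed
qed

lemma vimage_Fin_closure: "Fin -` closure Y = closure (Fin -` Y)"
  by (simp add: closure_interior vimage_Compl vimage_Fin_interior)

lemma vimage_Fin_frontier: "Fin -` frontier Y = frontier (Fin -` Y)"
  by (simp add: frontier_def vimage_Diff vimage_Fin_closure vimage_Fin_interior)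

lemma open_ball_Infty: "open (ball_Infty R)"
proof -
  have "Fin -` ball_Infty R = - cball 0 R"
    by (auto simp: ball_Infty_def)
  then show ?thesis
    by (auto simp: open_riemann_sphere_def)
qed

lemma ball_Infty_subset_open:
  assumes "open U" "Infty \<in> U"
  obtains R where "ball_Infty R \<subseteq> U"
proof -
  have "bounded (- (Fin -` U))"
    using assms by (simp add: open_riemann_sphere_def compact_imp_bounded)
  then obtain R where R: "\<And>z. Fin z \<notin> U \<Longrightarrow> norm z \<le> R"
    by (auto simp: bounded_iff)
  have "ball_Infty R \<subseteq> U"
    using assms(2) R by (force simp: ball_Infty_def)
  then show ?thesis by (rule that)
qed

lemma tendsto_Infty_iff:
  "(f \<longlongrightarrow> Infty) F \<longleftrightarrow> (\<forall>R. \<forall>\<^sub>F x in F. f x \<in> ball_Infty R)"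
proof
  show "\<forall>R. \<forall>\<^sub>F x in F. f x \<in> ball_Infty R" if "(f \<longlongrightarrow> Infty) F"
  proof
    fix R
    have "Infty \<in> ball_Infty R" by (simp add: ball_Infty_def)
    with that open_ball_Infty show "\<forall>\<^sub>F x in F. f x \<in> ball_Infty R"
      by (rule topological_tendstoD)
  qed
  assume *: "\<forall>R. \<forall>\<^sub>F x in F. f x \<in> ball_Infty R"
  show "(f \<longlongrightarrow> Infty) F"
  proof (rule topological_tendstoI)
    fix U :: "riemann_sphere set" assume "open U" "Infty \<in> U"
    then obtain R where "ball_Infty R \<subseteq> U"
      by (rule ball_Infty_subset_open)
    then show "\<forall>\<^sub>F x in F. f x \<in> U"
      using *[rule_format, of R] by (auto elim: eventually_mono)
  qed
qed

lemma Infty_notin_frontier: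
  assumes "ball_Infty R \<subseteq> - Y"
  shows "Infty \<notin> frontier Y"
proof -
  have "ball_Infty R \<subseteq> interior (- Y)"
    using assms open_ball_Infty by (rule interior_maximal)
  then show ?thesis
    by (auto simp: frontier_def interior_complement ball_Infty_def)
qed

section \<open>A rational map with prescribed bounded and escaping sets\<close>

lemma basin_Infty_iff: "z \<in> basin_Infty f \<longleftrightarrow> (\<forall>R. \<forall>\<^sub>F n in sequentially. (f ^^ n) z \<in> ball_Infty R)"
  by (simp add: basin_Infty_def tendsto_Infty_iff)

lemma bounded_invariant_subset_filled_julia:
  assumes bdd: "bounded E" and inv: "\<And>z. z \<in> E \<Longrightarrow> f (Fin z) \<in> Fin ` E"
  shows "Fin ` E \<subseteq> filled_julia f"
proof
  fix x assume x: "x \<in> Fin ` E"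
  obtain R where R: "\<And>z. z \<in> E \<Longrightarrow> norm z \<le> R"
    using bdd by (auto simp: bounded_iff)
  have "(f ^^ n) x \<in> Fin ` E" for n
    by (induction n) (use x inv in auto)
  moreover have "Fin ` E \<inter> ball_Infty R = {}"
    using R by (force simp: ball_Infty_def)
  ultimately have "\<not> (\<forall>\<^sub>F n in sequentially. (f ^^ n) x \<in> ball_Infty R)"
    by (metis (no_types, lifting) disjoint_iff eventually_sequentially order_refl)
  then show "x \<in> filled_julia f"
    unfolding filled_julia_def by (auto simp: basin_Infty_iff)
qed

text \<open>Finite points of an orbit move away from \<open>a\<close> by a factor of at least \<open>c\<close> in each
  step; an orbit that hits a pole stays at infinity.\<close>

lemma expanding_invariant_subset_basin:
  assumes Infty: "f Infty = Infty" and c: "c > 1"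
    and a: "a \<notin> F"
    and inv: "\<And>z w. z \<in> F \<Longrightarrow> f (Fin z) = Fin w \<Longrightarrow> w \<in> F \<and> c * norm (z - a) \<le> norm (w - a)"
  shows "Fin ` F \<subseteq> basin_Infty f"
proof
  fix x assume "x \<in> Fin ` F"
  then obtain z where z: "x = Fin z" "z \<in> F" by blast
  have orbit: "w \<in> F \<and> c ^ n * norm (z - a) \<le> norm (w - a)" if "(f ^^ n) x = Fin w" for n w
    using that
  proof (induction n arbitrary: w)
    case 0
    then show ?case using z by simp
  next
    case (Suc n)
    then obtain v where v: "(f ^^ n) x = Fin v"
      using Infty by (cases "(f ^^ n) x") auto
    then have v': "v \<in> F" "c ^ n * norm (z - a) \<le> norm (v - a)" "f (Fin v) = Fin w"
      using Suc by auto
    have "c ^ Suc n * norm (z - a) \<le> c * norm (v - a)"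
      using mult_left_mono[OF v'(2), of c] c by (simp add: mult.assoc)
    also have "\<dots> \<le> norm (w - a)"
      using inv[OF v'(1,3)] by simp
    finally show ?case
      using inv[OF v'(1,3)] by simp
  qed
  have pos: "norm (z - a) > 0"
    using z(2) a by auto
  show "x \<in> basin_Infty f"
    unfolding basin_Infty_iff
  proof
    fix R :: real
    obtain N where N: "(R + norm a) / norm (z - a) < c ^ N"
      using real_arch_pow[OF c] by blast
    have "(f ^^ n) x \<in> ball_Infty R" if "n \<ge> N" for n
    proof (cases "(f ^^ n) x")
      case Infty
      then show ?thesis by (simp add: ball_Infty_def)
    next
      case (Fin w)
      have "R + norm a < c ^ N * norm (z - a)"
        using N pos by (simp add: field_simps)
      also have "\<dots> \<le> c ^ n * norm (z - a)"
        using that c by (intro mult_right_mono power_increasing) auto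
      also have "\<dots> \<le> norm (w - a)"
        using orbit[OF Fin] by simp
      also have "\<dots> \<le> norm w + norm a"
        by (rule norm_triangle_ineq4)
      finally show ?thesis
        by (auto simp: Fin ball_Infty_def)
    qed
    then show "\<forall>\<^sub>F n in sequentially. (f ^^ n) x \<in> ball_Infty R"
      by (auto simp: eventually_sequentially)
  qed
qed

text \<open>In the chart at infinity the map is \<open>Q (1 / w) / P (1 / w)\<close>, and a degree gap of two makes
  this \<open>o(w)\<close>.\<close>

lemma superattracting_rat_eval:
  assumes deg: "degree Q + 1 < degree P"
  shows "attracting_fixpoint_Infty (rat_eval P Q)"
proof -
  let ?g = "chart_at_Infty (rat_eval P Q)"
  have Infty: "rat_eval P Q Infty = Infty"
    using deg by simp
  have g0: "?g 0 = 0"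
    using deg by (simp add: chart_at_Infty_def)
  (* division by zero makes the formula correct at the zeros of P and Q as well *)
  have g: "?g w = poly Q (inverse w) / poly P (inverse w)" if "w \<noteq> 0" for w
    using that by (auto simp: chart_at_Infty_def inverse_eq_divide)
  have "degree (pCons 0 Q) < degree P"
    using degree_pCons_le[of 0 Q] deg by linarith
  then have "((\<lambda>x. poly (pCons 0 Q) x / poly P x) \<longlongrightarrow> 0) at_infinity"
    by (rule poly_divide_tendsto_0_at_infinity)
  then have "((\<lambda>w. poly (pCons 0 Q) (inverse w) / poly P (inverse w)) \<longlongrightarrow> 0) (at 0)"
    by (rule filterlim_compose[OF _ filterlim_inverse_at_infinity])
  then have "((\<lambda>w. (?g w - ?g 0) / (w - 0)) \<longlongrightarrow> 0) (at 0)"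
    by (rule Lim_transform_eventually)
       (auto simp: g g0 eventually_at_filter field_simps)
  then have "(?g has_field_derivative 0) (at 0)"
    by (simp add: has_field_derivative_iff)
  then show ?thesis
    using Infty unfolding attracting_fixpoint_Infty_def by (intro conjI exI[of _ 0]) auto
qed

text \<open>With \<open>f = p / q\<close> close to the indicator of \<open>E\<close>, the function \<open>R = 1 / f - 1\<close> satisfies
  \<open>\<bar>R\<bar> \<le> 1 / 3\<close> on \<open>E\<close> and \<open>\<bar>R\<bar> \<ge> 3\<close> on \<open>F\<close>, where it may have poles.  For large \<open>n\<close> the map
  \<open>S(z) = a + (z - a) R(z)\<^sup>n\<close> contracts \<open>E\<close> into a small disk about \<open>a\<close> inside \<open>E\<close>, and it expands
  \<open>F\<close> away from \<open>a\<close>, past the bounded complement of \<open>F\<close> and therefore into \<open>F\<close> or to infinity.  The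
  factor \<open>z - a\<close> makes the expansion a multiple of the distance from \<open>a\<close>, so that it can be
  iterated without an estimate for the growth of \<open>R\<close>.\<close>

theorem rational_map_separating:
  fixes E F :: "complex set"
  assumes E: "compact E" and F: "closed F" "bounded (- F)" and disj: "E \<inter> F = {}"
    and a: "a \<in> interior E"
  obtains S where "rational_map S" "attracting_fixpoint_Infty S"
    "Fin ` E \<subseteq> filled_julia S" "insert Infty (Fin ` F) \<subseteq> basin_Infty S"
proof -
  obtain \<eta> where eta: "\<eta> > 0" "ball a \<eta> \<subseteq> E"
    using a by (auto simp: mem_interior)
  then have aE: "a \<in> E" by auto
  obtain M where M: "M > 0" "\<And>z. z \<notin> F \<Longrightarrow> norm (z - a) < M"
  proof -
    obtain B where "\<And>z. z \<notin> F \<Longrightarrow> norm z \<le> B"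
      using F(2) by (auto simp: bounded_iff)
    then have "norm (z - a) < \<bar>B\<bar> + norm a + 1" if "z \<notin> F" for z
      using norm_triangle_ineq4[of z a] that by fastforce
    then show ?thesis
      using norm_ge_zero[of a] abs_ge_zero[of B]
      by (intro that[of "\<bar>B\<bar> + norm a + 1"]) linarith+
  qed
  have far: "\<eta> \<le> norm (z - a)" if "z \<in> F" for z
  proof (rule ccontr)
    assume "\<not> ?thesis"
    then have "z \<in> ball a \<eta>" by (simp add: dist_norm norm_minus_commute)
    then show False using eta(2) disj that by blast
  qed
  obtain D where D: "D > 0" "\<And>z. z \<in> E \<Longrightarrow> norm (z - a) \<le> D"
  proof -
    obtain D where "\<And>z. z \<in> E \<Longrightarrow> dist a z \<le> D"
      using compact_imp_bounded[OF E] by (auto simp: bounded_any_center[of _ a])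
    then have "norm (z - a) \<le> \<bar>D\<bar> + 1" if "z \<in> E" for z
      using that by (force simp: dist_norm norm_minus_commute)
    then show ?thesis by (intro that[of "\<bar>D\<bar> + 1"]) auto
  qed
  obtain p q :: "complex poly" where pq: "coprime p q" "degree p < degree q"
    and q: "\<And>z. z \<in> E \<union> F \<Longrightarrow> poly q z \<noteq> 0"
    and fE: "\<And>z. z \<in> E \<Longrightarrow> norm (poly p z / poly q z - 1) \<le> 1 / 4"
    and fF: "\<And>z. z \<in> F \<Longrightarrow> norm (poly p z / poly q z) \<le> 1 / 4"
    using rational_approx_indicator[OF E _ F(1) disj, of "1 / 4"] aE by auto
  have pE: "poly p z \<noteq> 0" if "z \<in> E" for z
    using fE[OF that] by auto
  have RE: "norm ((poly q z - poly p z) / poly p z) \<le> 1 / 3" if z: "z \<in> E" for z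
  proof -
    define f where "f = poly p z / poly q z"
    have "1 - norm f \<le> 1 / 4" "norm (1 - f) \<le> 1 / 4"
      using fE[OF z] norm_triangle_ineq2[of 1 f] by (auto simp: f_def norm_minus_commute)
    moreover have "(poly q z - poly p z) / poly p z = (1 - f) / f"
      using q[of z] pE[OF z] z by (simp add: f_def field_simps)
    ultimately show ?thesis
      by (simp add: norm_divide divide_le_eq)
  qed
  have RF: "3 \<le> norm ((poly q z - poly p z) / poly p z)" if z: "z \<in> F" and pz: "poly p z \<noteq> 0" for z
  proof -
    define f where "f = poly p z / poly q z"
    have "norm f \<le> 1 / 4" "1 - norm f \<le> norm (1 - f)"
      using fF[OF z] norm_triangle_ineq2[of 1 f] by (auto simp: f_def)
    moreover have "f \<noteq> 0"
      using pz q[of z] z by (simp add: f_def)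
    moreover have "(poly q z - poly p z) / poly p z = (1 - f) / f"
      using q[of z] pz z by (simp add: f_def field_simps)
    ultimately show ?thesis
      by (simp add: norm_divide le_divide_eq)
  qed
  (* n1 makes the image of E small, n2 carries F past its complement *)
  obtain n1 where n1: "D / \<eta> < 3 ^ n1"
    using real_arch_pow[of 3 "D / \<eta>"] by auto
  obtain n2 where n2: "M / \<eta> < 3 ^ n2"
    using real_arch_pow[of 3 "M / \<eta>"] by auto
  define n where "n = Suc (max n1 n2)"
  have "(3::real) ^ n1 \<le> 3 ^ n" "(3::real) ^ n2 \<le> 3 ^ n" "(3::real) ^ 1 \<le> 3 ^ n"
    unfolding n_def by (intro power_increasing; simp)+
  with n1 n2 eta have n: "n \<ge> 1" "D < 3 ^ n * \<eta>" "M < 3 ^ n * \<eta>" "(3::real) \<le> 3 ^ n"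
    by (auto simp: n_def divide_less_eq intro: less_le_trans mult_right_mono)
  define P where "P = smult a (p ^ n) + [:- a, 1:] * (q - p) ^ n"
  define Q where "Q = p ^ n"
  let ?S = "rat_eval P Q"
  have P_eval: "poly P z = a * poly p z ^ n + (z - a) * (poly q z - poly p z) ^ n" for z
    by (simp add: P_def algebra_simps)
  have Q_eval: "poly Q z = poly p z ^ n" for z
    by (simp add: Q_def)
  have S_eval: "poly P z / poly Q z = a + (z - a) * ((poly q z - poly p z) / poly p z) ^ n"
    if "poly p z \<noteq> 0" for z
    using that by (simp add: P_eval Q_eval add_divide_distrib power_divide)
  have p0: "p \<noteq> 0" using pE[OF aE] by auto
  (* a common root is a root of p, at which P reduces to (z - a) * q ^ n *)
  have "coprime P Q"
    unfolding coprime_poly_iff_no_common_root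
  proof
    assume "\<exists>z. poly P z = 0 \<and> poly Q z = 0"
    then obtain z where z: "poly P z = 0" "poly Q z = 0" by blast
    then have pz: "poly p z = 0"
      using n by (simp add: Q_eval)
    then have "z \<noteq> a" using pE[OF aE] by auto
    then have "poly q z = 0"
      using z(1) pz n by (simp add: P_eval power_0_left)
    then show False
      using pq(1) pz by (auto simp: coprime_poly_iff_no_common_root)
  qed
  moreover have "Q \<noteq> 0"
    using p0 by (simp add: Q_def)
  ultimately have rat: "rational_map ?S"
    unfolding rational_map_def by blast
  have degQ: "degree Q = n * degree p"
    using p0 by (simp add: Q_def degree_power_eq)
  have "degree (q - p) = degree q"
    using pq(2) by (metis degree_add_eq_left degree_minus diff_conv_add_uminus)
  moreover from this have "q - p \<noteq> 0"
    using pq(2) by auto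
  ultimately have degM: "degree ([:- a, 1:] * (q - p) ^ n) = Suc (n * degree q)"
    by (subst degree_mult_eq) (auto simp: degree_power_eq)
  have le: "n * Suc (degree p) \<le> n * degree q"
    using pq(2) by (intro mult_le_mono2) simp
  then have "degree (smult a (p ^ n)) < Suc (n * degree q)"
    using degree_smult_le[of a "p ^ n"] degQ by (simp add: Q_def)
  then have "degree P = Suc (n * degree q)"
    unfolding P_def using degM by (simp add: degree_add_eq_right)
  then have deg: "degree Q + 1 < degree P"
    using pq(2) n(1) by (simp add: degQ)
  have Infty: "?S Infty = Infty"
    using deg by simp
  have invE: "?S (Fin z) \<in> Fin ` E" if z: "z \<in> E" for z
  proof -
    let ?R = "(poly q z - poly p z) / poly p z"
    have "norm ((z - a) * ?R ^ n) \<le> D * (1 / 3) ^ n"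
      unfolding norm_mult norm_power using D(1) D(2)[OF z] RE[OF z]
      by (intro mult_mono power_mono) auto
    also have "\<dots> < \<eta>"
      using n(2) by (simp add: power_divide divide_less_eq mult.commute)
    finally have "a + (z - a) * ?R ^ n \<in> ball a \<eta>"
      by (simp add: dist_norm)
    then show ?thesis
      using eta(2) S_eval[OF pE[OF z]] pE[OF z] by (auto simp: Q_eval)
  qed
  have invF: "w \<in> F \<and> 3 * norm (z - a) \<le> norm (w - a)" if z: "z \<in> F" and w: "?S (Fin z) = Fin w" for z w
  proof -
    let ?R = "(poly q z - poly p z) / poly p z"
    have pz: "poly p z \<noteq> 0"
      using w n(1) by (auto simp: Q_eval split: if_splits)
    then have "w - a = (z - a) * ?R ^ n"
      using w S_eval[OF pz] by (simp add: Q_eval)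
    then have *: "3 ^ n * norm (z - a) \<le> norm (w - a)"
      using power_mono[OF RF[OF z pz], of n]
      by (simp add: norm_mult norm_power mult.commute mult_left_mono)
    have "3 ^ n * \<eta> \<le> 3 ^ n * norm (z - a)"
      using far[OF z] by (intro mult_left_mono) auto
    then have "M < 3 ^ n * norm (z - a)"
      using n(3) by linarith
    with * have "w \<in> F"
      using M(2)[of w] by force
    moreover have "3 * norm (z - a) \<le> 3 ^ n * norm (z - a)"
      using n(4) by (intro mult_right_mono) auto
    ultimately show ?thesis using * by linarith
  qed
  have "Fin ` E \<subseteq> filled_julia ?S"
    using compact_imp_bounded[OF E] invE by (rule bounded_invariant_subset_filled_julia)
  moreover have "Fin ` F \<subseteq> basin_Infty ?S"
  proof (rule expanding_invariant_subset_basin)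
    show "?S Infty = Infty"
      by (rule Infty)
    show "3 > (1::real)"
      by simp
    show "a \<notin> F"
      using aE disj by blast
    show "w \<in> F \<and> 3 * norm (z - a) \<le> norm (w - a)" if "z \<in> F" "?S (Fin z) = Fin w" for z w
      using that by (rule invF)
  qed
  moreover have "Infty \<in> basin_Infty ?S"
  proof -
    have "(?S ^^ k) Infty = Infty" for k
      by (induction k) (use Infty in auto)
    then show ?thesis by (simp add: basin_Infty_def)
  qed
  ultimately show ?thesis
    using rat superattracting_rat_eval[OF deg] by (intro that) auto
qed

section \<open>Approximation by filled Julia sets\<close>

text \<open>Let \<open>\<epsilon>\<close> be small, \<open>E\<close> the set \<open>X\<close> eroded by \<open>\<epsilon>\<close> and \<open>F\<close> the complement of \<open>X\<close> eroded by \<open>\<epsilon>\<close>.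
  Separating \<open>E\<close> from \<open>F\<close> dynamically squeezes the filled Julia set between them.  That \<open>X\<close> is the
  closure of its interior is what makes \<open>E\<close> come close to every point of \<open>X\<close>; the analogue for
  the complement is automatic, since the complement is open.\<close>

theorem regular_compact_set_approximation:
  fixes X :: "complex set" and \<delta> :: real
  assumes compact: "compact X" and regular: "closure (interior X) = X" and ne: "X \<noteq> {}"
    and delta: "\<delta> > 0"
  obtains S where "rational_map S" "attracting_fixpoint_Infty S"
    "sphere_hausdorff_dist (Fin ` X) (filled_julia S) < ereal \<delta>"
    "sphere_hausdorff_dist (- Fin ` X) (basin_Infty S) < ereal \<delta>"
    "sphere_hausdorff_dist (frontier (Fin ` X)) (julia S) < ereal \<delta>"
proof -
  define V where "V = interior X"
  have VX: "V \<subseteq> X" and V: "open V" "V \<noteq> {}"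
    using ne regular interior_subset[of X] by (auto simp: V_def)
  have bddX: "bounded X" and clX: "closed X"
    using compact by (simp_all add: compact_imp_bounded compact_imp_closed)
  have bddV: "bounded V"
    using bddX VX by (rule bounded_subset)
  (* the frontiers are only controlled up to 2 * e *)
  define e where "e = \<delta> / 3"
  have e: "e > 0" "e < \<delta>" "2 * e < \<delta>"
    using delta by (auto simp: e_def)
  obtain B where B: "\<And>x. x \<in> X \<Longrightarrow> norm x \<le> B"
    using bddX by (auto simp: bounded_iff)
  (* the disk of radius B + e contains the complement of F, and R has to exceed that radius *)
  define R where "R = B + 2 * e"
  have XR: "X \<subseteq> cball 0 (R - e)"
    using B e(1) by (force simp: R_def)
  obtain \<epsilon>1 where \<epsilon>1: "\<epsilon>1 > 0"
    "\<And>x. x \<in> V \<inter> UNIV \<Longrightarrow> \<exists>y\<in>V \<inter> UNIV. dist x y < e / 2 \<and> ball y \<epsilon>1 \<subseteq> V"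
    using uniform_inner_approx[of V UNIV "e / 2"] V(1) bddV e by auto
  obtain \<epsilon>2 where \<epsilon>2: "\<epsilon>2 > 0"
    "\<And>x. x \<in> - X \<inter> cball 0 R \<Longrightarrow> \<exists>y\<in>- X \<inter> cball 0 R. dist x y < e \<and> ball y \<epsilon>2 \<subseteq> - X"
    using uniform_inner_approx[of "- X" "cball 0 R" e] clX e by (auto simp: bounded_Int)
  (* the factor 1 / 2 leaves room for a whole disk of radius \<epsilon> inside E *)
  define \<epsilon> where "\<epsilon> = min (min (\<epsilon>1 / 2) \<epsilon>2) e"
  have \<epsilon>: "\<epsilon> > 0" "\<epsilon> \<le> \<epsilon>1 / 2" "\<epsilon> \<le> \<epsilon>2" "\<epsilon> \<le> e"
    using \<epsilon>1(1) \<epsilon>2(1) e by (auto simp: \<epsilon>_def)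
  let ?E = "inner_part \<epsilon> X" and ?F = "inner_part \<epsilon> (- X)"
  have inner: "\<exists>y\<in>?E. dist x y < e" if "x \<in> X" for x
  proof -
    have "x \<in> closure V"
      using that regular by (simp add: V_def)
    then obtain x' where x': "x' \<in> V" "dist x' x < e / 2"
      using e(1) unfolding closure_approachable by (meson half_gt_zero)
    then obtain y where y: "dist x' y < e / 2" "ball y \<epsilon>1 \<subseteq> V"
      using \<epsilon>1(2) by auto
    have "ball y \<epsilon> \<subseteq> ball y \<epsilon>1"
      using \<epsilon> \<epsilon>1(1) by (intro subset_ball) auto
    then have "y \<in> ?E"
      using y(2) VX by (auto simp: inner_part_def)
    moreover have "dist x y < e"
      using dist_triangle[of x y x'] x'(2) y(1) by (simp add: dist_commute)
    ultimately show ?thesis by blast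
  qed
  have outer: "\<exists>y\<in>?F. norm y \<le> R \<and> dist x y < e" if "x \<notin> X" "norm x \<le> R" for x
  proof -
    obtain y where y: "norm y \<le> R" "dist x y < e" "ball y \<epsilon>2 \<subseteq> - X"
      using \<epsilon>2(2)[of x] \<open>x \<notin> X\<close> \<open>norm x \<le> R\<close> by auto
    then have "y \<in> ?F"
      using subset_ball[OF \<epsilon>(3), of y] by (auto simp: inner_part_def)
    with y show ?thesis by blast
  qed
  obtain a where a: "a \<in> interior ?E"
  proof -
    obtain a where a: "ball a \<epsilon>1 \<subseteq> V"
      using V(2) \<epsilon>1(2) by fastforce
    have "ball a \<epsilon> \<subseteq> ?E"
    proof
      fix y assume "y \<in> ball a \<epsilon>"
      then have "ball y \<epsilon> \<subseteq> ball a \<epsilon>1"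
        using \<epsilon>(2) by (auto simp: subset_iff) (smt (verit) dist_triangle field_sum_of_halves)
      then show "y \<in> ?E"
        using a VX by (auto simp: inner_part_def)
    qed
    then show ?thesis
      using that[of a] \<epsilon>(1) by (auto simp: mem_interior)
  qed
  have big: "norm y \<le> B + e" if y: "y \<notin> ?F" for y
  proof -
    obtain x where x: "x \<in> X" "dist y x < \<epsilon>"
      using y by (auto simp: notin_inner_part)
    then show ?thesis
      using B[OF x(1)] norm_triangle_sub[of y x] \<epsilon>(4) by (simp add: dist_norm)
  qed
  have "compact ?E"
    using bddX inner_part_subset[OF \<epsilon>(1), of X] closed_inner_part
    by (metis bounded_subset compact_eq_bounded_closed)
  moreover have "bounded (- ?F)"
    using big by (auto simp: bounded_iff)
  moreover have "?E \<inter> ?F = {}"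
    using inner_part_subset[OF \<epsilon>(1), of X] inner_part_subset[OF \<epsilon>(1), of "- X"] by blast
  ultimately obtain S where S: "rational_map S" "attracting_fixpoint_Infty S"
    "Fin ` ?E \<subseteq> filled_julia S" "insert Infty (Fin ` ?F) \<subseteq> basin_Infty S"
    using rational_map_separating[of ?E ?F a] closed_inner_part a by blast
  define K where "K = Fin -` filled_julia S"
  have K: "?E \<subseteq> K" "K \<inter> ?F = {}"
    using S(3,4) by (auto simp: K_def filled_julia_def)
  note bounds = hausdorff_dist_between_inner_parts[OF \<epsilon>(1,4) K clX XR inner outer]
  have ball_F: "ball_Infty (B + e) \<subseteq> insert Infty (Fin ` ?F)"
    using big by (force simp: ball_Infty_def)
  then have ball_basin: "ball_Infty (B + e) \<subseteq> basin_Infty S"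
    using S(4) by blast
  have InftyK: "Infty \<notin> filled_julia S"
    using S(4) by (simp add: filled_julia_def)
  have ball_X: "ball_Infty (B + e) \<subseteq> - Fin ` X"
    using ball_F inner_part_subset[OF \<epsilon>(1), of "- X"] by blast
  have vX: "Fin -` (Fin ` X) = X"
    by (simp add: inj_vimage_image_eq inj_def)
  have "sphere_hausdorff_dist (Fin ` X) (filled_julia S) \<le> ereal e"
    using bounds(1) InftyK by (auto simp: sphere_hausdorff_dist_def vX K_def)
  moreover have "sphere_hausdorff_dist (- Fin ` X) (basin_Infty S) \<le> ereal e"
  proof -
    have "ball_Infty (B + e) \<subseteq> - Fin ` X \<inter> basin_Infty S"
      using ball_X ball_basin by blast
    then have "sphere_hausdorff_dist (- Fin ` X) (basin_Infty S) =
        hausdorff_dist (Fin -` (- Fin ` X - ball_Infty R)) (Fin -` (basin_Infty S - ball_Infty R))"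
      by (rule sphere_hausdorff_dist_eq) (use e in \<open>simp add: R_def\<close>)
    also have "Fin -` (- Fin ` X - ball_Infty R) = - X \<inter> cball 0 R"
      unfolding vimage_Diff_ball_Infty by auto
    also have "Fin -` (basin_Infty S - ball_Infty R) = - K \<inter> cball 0 R"
      unfolding vimage_Diff_ball_Infty by (auto simp: K_def filled_julia_def)
    finally show ?thesis
      using bounds(2) by simp
  qed
  moreover have "sphere_hausdorff_dist (frontier (Fin ` X)) (julia S) \<le> ereal (2 * e)"
  proof -
    have "Infty \<notin> frontier (Fin ` X)"
      using ball_X by (rule Infty_notin_frontier)
    moreover have "Infty \<notin> julia S"
      unfolding julia_def using ball_basin
      by (intro Infty_notin_frontier[of "B + e"]) (simp add: filled_julia_def)
    ultimately show ?thesis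
      using bounds(3) by (simp add: sphere_hausdorff_dist_def julia_def vimage_Fin_frontier vX K_def)
  qed
  ultimately show ?thesis
    using S(1,2) e by (intro that[of S]) (auto intro: le_less_trans)
qed

text \<open>A closed annulus is the closure of an open set, and it is bounded, so it is a nonempty
  compact set that is the closure of its interior.\<close>

theorem theorem3p4:
  fixes A A_inf A_0 :: "riemann_sphere set" and \<delta> :: real
  assumes "A \<in> closed_annuli"
    and "topological_disk A_inf" and "topological_disk A_0"
    and "- A = A_inf \<union> A_0" and "A_inf \<inter> A_0 = {}" and "Infty \<in> A_inf"
    and "\<delta> > 0"
  shows "\<exists>S. rational_map S \<and> attracting_fixpoint_Infty S \<and>
           sphere_hausdorff_dist A (filled_julia S) < ereal \<delta> \<and>
           sphere_hausdorff_dist (A_inf \<union> A_0) (basin_Infty S) < ereal \<delta> \<and>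
           sphere_hausdorff_dist (frontier A) (julia S) < ereal \<delta>"
proof -
  obtain U R where A: "A = closure U" and U: "open_annulus U" "U \<inter> ball_Infty R = {}"
    using assms(1) by (auto simp: closed_annuli_def)
  have InftyA: "Infty \<notin> A"
    using assms(4,6) by blast
  define V where "V = Fin -` U"
  define X where "X = Fin -` A"
  have X: "X = closure V"
    by (simp add: X_def V_def A vimage_Fin_closure)
  have FinX: "Fin ` X = A"
  proof
    show "A \<subseteq> Fin ` X"
    proof
      fix x assume "x \<in> A"
      then show "x \<in> Fin ` X"
        using InftyA by (cases x) (auto simp: X_def)
    qed
  qed (auto simp: X_def)
  have "bounded V"
    using U(2) unfolding bounded_iff V_def
    by (intro exI[of _ R]) (force simp: ball_Infty_def not_less)
  then have "compact X"
    by (simp add: X compact_closure)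
  moreover have "closure (interior X) = X"
  proof
    have "open V"
      using U(1) by (simp add: V_def open_annulus_def open_vimage_Fin)
    then have "V \<subseteq> interior X"
      using closure_subset[of V] by (intro interior_maximal) (simp_all add: X)
    then show "X \<subseteq> closure (interior X)"
      unfolding X by (rule closure_mono)
    show "closure (interior X) \<subseteq> X"
      by (simp add: X closure_minimal interior_subset)
  qed
  moreover have "X \<noteq> {}"
  proof
    assume "X = {}"
    then have "U = {}"
      using FinX A closure_subset[of U] by blast
    then have "{z::complex. 1 < norm z \<and> norm z < 2} = {}"
      using U(1) by (auto simp: open_annulus_def)
    moreover have "(3 / 2 :: complex) \<in> {z. 1 < norm z \<and> norm z < 2}"
      by (simp add: norm_divide)
    ultimately show False by blast
  qed
  ultimately obtain S where "rational_map S" "attracting_fixpoint_Infty S"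
    "sphere_hausdorff_dist (Fin ` X) (filled_julia S) < ereal \<delta>"
    "sphere_hausdorff_dist (- Fin ` X) (basin_Infty S) < ereal \<delta>"
    "sphere_hausdorff_dist (frontier (Fin ` X)) (julia S) < ereal \<delta>"
    using assms(7) by (rule regular_compact_set_approximation)
  then show ?thesis
    unfolding FinX assms(4) by blast
qed

end
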